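(* Let $n\in\mathbb N$ and let $(\Omega,\mathcal F,(\mathcal F_t)_{t\ge0},P)$ be a filtered probability space satisfying the usual conditions. Let $\mathcal A_n=L^\infty(\Omega,\mathcal F,P;M_n(\mathbb C))$, $\mathcal A_{n,t}=L^\infty(\Omega,\mathcal F_t,P;M_n(\mathbb C))$, and $\tau_n=\mathbb E_P[\mathrm{tr}_n(\cdot)]$. If $X:\mathbb R_+\times\Omega\to M_n(\mathbb C)_{\mathrm{sa}}$ is an $n\times n$ Hermitian Brownian motion (with respect to $\langle\cdot,\cdot\rangle_{L^2(\mathrm{tr}_n)}$) and $1\le p<\infty$, then the noncommutative martingale $\mathbb R_+\ni t\mapsto X(t,\cdot)\in L^p(\mathcal A_n,\tau_n)$ belongs to $\widetilde{\mathbb M}{}^p_{\tau_n}$.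
   Context: $\mathrm{tr}_n=\frac1n\mathrm{Tr}_n$ is the normalized trace and $\langle a,b\rangle_{L^2(\mathrm{tr}_n)}=\mathrm{tr}_n(b^*a)$. The usual conditions: $\mathcal F_t=\bigcap_{u>t}\mathcal F_u$ and $\mathcal F_0$ contains all subsets of $P$-null sets. $(\mathcal A_n,(\mathcal A_{n,t})_{t\ge0},\tau_n)$ is a filtered $\mathrm W^*$-probability space; $L^p(\mathcal A_n,\tau_n)=L^p(\Omega,\mathcal F,P;M_n(\mathbb C))$ with $\|A\|_p=\mathbb E_P[\mathrm{tr}_n(|A|^p)]^{1/p}$, $\|\cdot\|_\infty$ is the $P$-essential supremum of the operator norm, and the conditional expectation onto $\mathcal A_{n,t}$ is the classical $\mathbb E_P[\,\cdot\mid\mathcal F_t]$ (entrywise). A Hermitian Brownian motion with respect to $\langle\cdot,\cdot\rangle_{L^2(\mathrm{tr}_n)}$ is an adapted continuous process in $M_n(\mathbb C)_{\mathrm{sa}}$ that is a standard Brownian motion (relative to $(\mathcal F_t)$) on the real inner product space $(M_n(\mathbb C)_{\mathrm{sa}},\langle\cdot,\cdot\rangle_{L^2(\mathrm{tr}_n)})$, i.e. its coordinates in an orthonormal basis form a standard $(\mathcal F_t)$-Brownian motion in $\mathbb R^{n^2}$. $\mathbb M^p_{\tau_n}$ is the space of $L^p$-continuous $L^p$-martingales $M:\mathbb R_+\to L^p(\mathcal A_n,\tau_n)$ (i.e. $M(t)\in L^p(\mathcal A_{n,t},\tau_n)$ and $\tau_n[M(t)\mid\mathcal A_{n,s}]=M(s)$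 for $s\le t$) with the topology of $L^p$-convergence uniform on compact subsets of $\mathbb R_+$; $\mathbb M^\infty_{\tau_n}$ is the space of $\|\cdot\|_\infty$-continuous martingales $\mathbb R_+\to\mathcal A_n$; $\widetilde{\mathbb M}{}^p_{\tau_n}$ is the closure of $\mathbb M^\infty_{\tau_n}$ in $\mathbb M^p_{\tau_n}$. *)

theory Defs
  imports "HOL-Probability.Probability"
begin

section \<open>Complex matrices\<close>

definition ctransp :: "complex^'n^'m \<Rightarrow> complex^'m^'n" where
  "ctransp A = (\<chi> i j. cnj (A $ j $ i))"

definition hermitian :: "complex^'n^'n \<Rightarrow> bool" where
  "hermitian A \<longleftrightarrow> ctransp A = A"

definition unitary :: "complex^'n^'n \<Rightarrow> bool" where
  "unitary U \<longleftrightarrow> ctransp U ** U = mat 1 \<and> U ** ctransp U = mat 1"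

definition diag :: "('n \<Rightarrow> real) \<Rightarrow> complex^'n^'n" where
  "diag d = (\<chi> i j. if i = j then complex_of_real (d i) else 0)"

text \<open>Functional calculus \<open>f(H) = U f(D) U\<^sup>*\<close> for \<open>H = U D U\<^sup>*\<close> Hermitian; the
  result does not depend on the diagonalization.  It is unspecified for other \<open>H\<close>.\<close>

definition hermitian_fun :: "(real \<Rightarrow> real) \<Rightarrow> complex^'n^'n \<Rightarrow> complex^'n^'n" where
  "hermitian_fun f H =
    (THE B. \<exists>U d. unitary U \<and> H = U ** diag d ** ctransp U
                \<and> B = U ** diag (\<lambda>i. f (d i)) ** ctransp U)"

definition mat_abs :: "complex^'n^'n \<Rightarrow> complex^'n^'n" where
  "mat_abs A = hermitian_fun sqrt (ctransp A ** A)"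

definition mat_powr :: "complex^'n^'n \<Rightarrow> real \<Rightarrow> complex^'n^'n" where
  "mat_powr H p = hermitian_fun (\<lambda>x. x powr p) H"

definition ntrace :: "complex^'n^'n \<Rightarrow> complex" where
  "ntrace A = trace A / of_nat CARD('n)"

definition tr_inner :: "complex^'n^'n \<Rightarrow> complex^'n^'n \<Rightarrow> complex" where
  "tr_inner a b = ntrace (ctransp b ** a)"

definition mat_opnorm :: "complex^'n^'n \<Rightarrow> real" where
  "mat_opnorm A = onorm (\<lambda>v. A *v v)"

text \<open>Orthonormal bases of the real inner product space of Hermitian matrices
  (\<open>span\<close> is the real span).\<close>

definition hermitian_onb :: "(complex^'n^'n) set \<Rightarrow> bool" where
  "hermitian_onb E \<longleftrightarrow> finite E
     \<and> (\<forall>e\<in>E. \<forall>f\<in>E. tr_inner e f = (if e = f then 1 else 0))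
     \<and> span E = {A. hermitian A}"

section \<open>Filtered probability spaces and Brownian motion\<close>

text \<open>Time is \<open>real\<close>, with all conditions restricted to \<open>t \<ge> 0\<close>; the values of filtrations and
  processes at negative times are irrelevant.\<close>

definition filtered_prob_space :: "'w measure \<Rightarrow> (real \<Rightarrow> 'w measure) \<Rightarrow> bool" where
  "filtered_prob_space P F \<longleftrightarrow> prob_space P
     \<and> (\<forall>t\<ge>0. subalgebra P (F t))
     \<and> (\<forall>s t. 0 \<le> s \<longrightarrow> s \<le> t \<longrightarrow> sets (F s) \<subseteq> sets (F t))"

definition usual_conditions :: "'w measure \<Rightarrow> (real \<Rightarrow> 'w measure) \<Rightarrow> bool" where
  "usual_conditions P F \<longleftrightarrow>
     (\<forall>t\<ge>0. sets (F t) = (\<Inter>u\<in>{t<..}. sets (F u)))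
     \<and> (\<forall>N\<in>null_sets P. \<forall>S. S \<subseteq> N \<longrightarrow> S \<in> sets (F 0))"

text \<open>Standard \<open>(F\<^sub>t)\<close>-Brownian motion in \<open>\<real>\<^sup>I\<close>, \<open>I\<close> finite: for \<open>s < t\<close> the vector of increments is
  independent of \<open>F\<^sub>s\<close> and has law \<open>N(0, (t - s) Id)\<close>, a product of one-dimensional normal laws.\<close>

definition std_brownian ::
  "'w measure \<Rightarrow> (real \<Rightarrow> 'w measure) \<Rightarrow> 'i set \<Rightarrow> ('i \<Rightarrow> real \<Rightarrow> 'w \<Rightarrow> real) \<Rightarrow> bool" where
  "std_brownian P F I W \<longleftrightarrow> finite I
     \<and> (\<forall>i\<in>I. \<forall>t\<ge>0. W i t \<in> borel_measurable (F t))
     \<and> (\<forall>i\<in>I. AE \<omega> in P. W i 0 \<omega> = 0)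
     \<and> (\<forall>i\<in>I. AE \<omega> in P. continuous_on {0..} (\<lambda>t. W i t \<omega>))
     \<and> (\<forall>s t. 0 \<le> s \<longrightarrow> s < t \<longrightarrow>
          (let \<Delta> = (\<lambda>\<omega>. \<lambda>i\<in>I. W i t \<omega> - W i s \<omega>) in
            prob_space.indep_set P (sets (F s))
              {\<Delta> -` B \<inter> space P | B. B \<in> sets (PiM I (\<lambda>_. borel))}
            \<and> distr P (PiM I (\<lambda>_. borel)) \<Delta>
               = PiM I (\<lambda>_. density lborel (\<lambda>x. ennreal (normal_density 0 (sqrt (t - s)) x)))))"

definition hermitian_brownian ::
  "'w measure \<Rightarrow> (real \<Rightarrow> 'w measure) \<Rightarrow> (real \<Rightarrow> 'w \<Rightarrow> complex^'n^'n) \<Rightarrow> bool" where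
  "hermitian_brownian P F X \<longleftrightarrow>
     (\<forall>t\<ge>0. \<forall>\<omega>\<in>space P. hermitian (X t \<omega>))
     \<and> (\<forall>t\<ge>0. X t \<in> borel_measurable (F t))
     \<and> (AE \<omega> in P. continuous_on {0..} (\<lambda>t. X t \<omega>))
     \<and> (\<exists>E. hermitian_onb E \<and> std_brownian P F E (\<lambda>e t \<omega>. Re (tr_inner (X t \<omega>) e)))"

section \<open>Noncommutative \<open>L\<^sup>p\<close> spaces and martingales\<close>

text \<open>Elements of \<open>L\<^sup>p\<close> are given by representatives.  Under the usual conditions every function that
  is almost everywhere equal to an \<open>F\<^sub>t\<close>-measurable one is \<open>F\<^sub>t\<close>-measurable, so none of the notions
  below depends on the choice of representatives.  Here \<open>G\<close> is a sub-\<open>\<sigma>\<close>-algebra of \<open>P\<close>.\<close>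

definition Lp_norm :: "'w measure \<Rightarrow> real \<Rightarrow> ('w \<Rightarrow> complex^'n^'n) \<Rightarrow> real" where
  "Lp_norm P p A = (LINT \<omega>|P. Re (ntrace (mat_powr (mat_abs (A \<omega>)) p))) powr (1 / p)"

definition Lp_mat :: "'w measure \<Rightarrow> 'w measure \<Rightarrow> real \<Rightarrow> ('w \<Rightarrow> complex^'n^'n) set" where
  "Lp_mat P G p = {A. A \<in> borel_measurable G
     \<and> integrable P (\<lambda>\<omega>. Re (ntrace (mat_powr (mat_abs (A \<omega>)) p)))}"

definition Linf_norm :: "'w measure \<Rightarrow> ('w \<Rightarrow> complex^'n^'n) \<Rightarrow> ereal" where
  "Linf_norm P A = esssup P (\<lambda>\<omega>. ereal (mat_opnorm (A \<omega>)))"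

definition Linf_mat :: "'w measure \<Rightarrow> 'w measure \<Rightarrow> ('w \<Rightarrow> complex^'n^'n) set" where
  "Linf_mat P G = {A. A \<in> borel_measurable G \<and> Linf_norm P A < \<infinity>}"

definition mat_cond_exp ::
  "'w measure \<Rightarrow> 'w measure \<Rightarrow> ('w \<Rightarrow> complex^'n^'n) \<Rightarrow> 'w \<Rightarrow> complex^'n^'n" where
  "mat_cond_exp P G A = (\<lambda>\<omega>. \<chi> i j. Complex
     (real_cond_exp P G (\<lambda>\<omega>. Re (A \<omega> $ i $ j)) \<omega>)
     (real_cond_exp P G (\<lambda>\<omega>. Im (A \<omega> $ i $ j)) \<omega>))"

definition martingale_property ::
  "'w measure \<Rightarrow> (real \<Rightarrow> 'w measure) \<Rightarrow> (real \<Rightarrow> 'w \<Rightarrow> complex^'n^'n) \<Rightarrow> bool" where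
  "martingale_property P F M \<longleftrightarrow>
     (\<forall>s t. 0 \<le> s \<longrightarrow> s \<le> t \<longrightarrow> (AE \<omega> in P. mat_cond_exp P (F s) (M t) \<omega> = M s \<omega>))"

definition Lp_martingales ::
  "'w measure \<Rightarrow> (real \<Rightarrow> 'w measure) \<Rightarrow> real \<Rightarrow> (real \<Rightarrow> 'w \<Rightarrow> complex^'n^'n) set" where
  "Lp_martingales P F p = {M. (\<forall>t\<ge>0. M t \<in> Lp_mat P (F t) p)
     \<and> martingale_property P F M
     \<and> (\<forall>t\<ge>0. ((\<lambda>s. Lp_norm P p (\<lambda>\<omega>. M s \<omega> - M t \<omega>)) \<longlongrightarrow> 0) (at t within {0..}))}"

definition Linf_martingales ::
  "'w measure \<Rightarrow> (real \<Rightarrow> 'w measure) \<Rightarrow> (real \<Rightarrow> 'w \<Rightarrow> complex^'n^'n) set" where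
  "Linf_martingales P F = {M. (\<forall>t\<ge>0. M t \<in> Linf_mat P (F t))
     \<and> martingale_property P F M
     \<and> (\<forall>t\<ge>0. ((\<lambda>s. Linf_norm P (\<lambda>\<omega>. M s \<omega> - M t \<omega>)) \<longlongrightarrow> 0) (at t within {0..}))}"

text \<open>The topology of \<open>L\<^sup>p\<close>-convergence uniform on compact subsets \<open>K\<close> of \<open>[0, \<infinity>)\<close>: a set is open iff it
  contains, around each of its points, a ball for one of the (directed family of) seminorms
  \<open>M \<mapsto> sup\<^bsub>t\<in>K\<^esub> \<parallel>M(t)\<parallel>\<^sub>p\<close>.\<close>

definition Lp_open ::
  "'w measure \<Rightarrow> (real \<Rightarrow> 'w measure) \<Rightarrow> real \<Rightarrow> (real \<Rightarrow> 'w \<Rightarrow> complex^'n^'n) set \<Rightarrow> bool" where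
  "Lp_open P F p U \<longleftrightarrow> U \<subseteq> Lp_martingales P F p
     \<and> (\<forall>M\<in>U. \<exists>K \<epsilon>. compact K \<and> K \<subseteq> {0..} \<and> \<epsilon> > 0
          \<and> (\<forall>N\<in>Lp_martingales P F p.
               (\<forall>t\<in>K. Lp_norm P p (\<lambda>\<omega>. N t \<omega> - M t \<omega>) < \<epsilon>) \<longrightarrow> N \<in> U))"

definition Lp_topology ::
  "'w measure \<Rightarrow> (real \<Rightarrow> 'w measure) \<Rightarrow> real \<Rightarrow> (real \<Rightarrow> 'w \<Rightarrow> complex^'n^'n) topology" where
  "Lp_topology P F p = topology (Lp_open P F p)"

lemma Lp_openD:
  assumes "Lp_open P F p U" "M \<in> U"
  obtains K \<epsilon> where "compact K" "K \<subseteq> {0..}" "\<epsilon> > 0"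
    "\<forall>N\<in>Lp_martingales P F p. (\<forall>t\<in>K. Lp_norm P p (\<lambda>\<omega>. N t \<omega> - M t \<omega>) < \<epsilon>) \<longrightarrow> N \<in> U"
proof -
  from assms have "\<exists>K \<epsilon>. compact K \<and> K \<subseteq> {0..} \<and> \<epsilon> > 0
          \<and> (\<forall>N\<in>Lp_martingales P F p.
               (\<forall>t\<in>K. Lp_norm P p (\<lambda>\<omega>. N t \<omega> - M t \<omega>) < \<epsilon>) \<longrightarrow> N \<in> U)"
    unfolding Lp_open_def by (elim conjE) (erule bspec)
  then show thesis
    by (elim exE conjE) (rule that)
qed

lemma Lp_openI:
  assumes "U \<subseteq> Lp_martingales P F p"
    and "\<And>M. M \<in> U \<Longrightarrow> \<exists>K \<epsilon>. compact K \<and> K \<subseteq> {0..} \<and> \<epsilon> > 0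
          \<and> (\<forall>N\<in>Lp_martingales P F p.
               (\<forall>t\<in>K. Lp_norm P p (\<lambda>\<omega>. N t \<omega> - M t \<omega>) < \<epsilon>) \<longrightarrow> N \<in> U)"
  shows "Lp_open P F p U"
  unfolding Lp_open_def by (intro conjI ballI assms)

lemma istopology_Lp_open: "istopology (Lp_open P F p)"
  unfolding istopology_def
proof (intro conjI allI impI)
  fix S T :: "(real \<Rightarrow> 'a \<Rightarrow> complex^'b^'b) set"
  assume S: "Lp_open P F p S" and T: "Lp_open P F p T"
  show "Lp_open P F p (S \<inter> T)"
  proof (rule Lp_openI)
    show "S \<inter> T \<subseteq> Lp_martingales P F p"
      using S by (auto simp: Lp_open_def)
    fix M assume M: "M \<in> S \<inter> T"
    obtain K a where K: "compact K" "K \<subseteq> {0..}" "a > 0"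
      and KS: "\<forall>N\<in>Lp_martingales P F p. (\<forall>t\<in>K. Lp_norm P p (\<lambda>\<omega>. N t \<omega> - M t \<omega>) < a) \<longrightarrow> N \<in> S"
      using Lp_openD[OF S IntD1[OF M]] .
    obtain L b where L: "compact L" "L \<subseteq> {0..}" "b > 0"
      and LT: "\<forall>N\<in>Lp_martingales P F p. (\<forall>t\<in>L. Lp_norm P p (\<lambda>\<omega>. N t \<omega> - M t \<omega>) < b) \<longrightarrow> N \<in> T"
      using Lp_openD[OF T IntD2[OF M]] .
    show "\<exists>K \<epsilon>. compact K \<and> K \<subseteq> {0..} \<and> \<epsilon> > 0
          \<and> (\<forall>N\<in>Lp_martingales P F p.
               (\<forall>t\<in>K. Lp_norm P p (\<lambda>\<omega>. N t \<omega> - M t \<omega>) < \<epsilon>) \<longrightarrow> N \<in> S \<inter> T)"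
    proof (intro exI conjI ballI impI)
      show "compact (K \<union> L)" "K \<union> L \<subseteq> {0..}" "min a b > 0"
        using K L by (simp_all add: compact_Un)
      fix N assume N: "N \<in> Lp_martingales P F p"
        and less: "\<forall>t\<in>K \<union> L. Lp_norm P p (\<lambda>\<omega>. N t \<omega> - M t \<omega>) < min a b"
      show "N \<in> S \<inter> T"
        using less by (intro IntI KS[rule_format, OF N] LT[rule_format, OF N]) simp_all
    qed
  qed
next
  fix \<K> :: "(real \<Rightarrow> 'a \<Rightarrow> complex^'b^'b) set set"
  assume *: "\<forall>S\<in>\<K>. Lp_open P F p S"
  show "Lp_open P F p (\<Union>\<K>)"
  proof (rule Lp_openI)
    show "\<Union>\<K> \<subseteq> Lp_martingales P F p"
      using * by (auto simp: Lp_open_def)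
    fix M assume "M \<in> \<Union>\<K>"
    then obtain S where S: "S \<in> \<K>" "M \<in> S" by blast
    obtain K a where K: "compact K" "K \<subseteq> {0..}" "a > 0"
      and KS: "\<forall>N\<in>Lp_martingales P F p. (\<forall>t\<in>K. Lp_norm P p (\<lambda>\<omega>. N t \<omega> - M t \<omega>) < a) \<longrightarrow> N \<in> S"
      using Lp_openD[OF bspec[OF * S(1)] S(2)] .
    show "\<exists>K \<epsilon>. compact K \<and> K \<subseteq> {0..} \<and> \<epsilon> > 0
          \<and> (\<forall>N\<in>Lp_martingales P F p.
               (\<forall>t\<in>K. Lp_norm P p (\<lambda>\<omega>. N t \<omega> - M t \<omega>) < \<epsilon>) \<longrightarrow> N \<in> \<Union>\<K>)"
      by (intro exI[of _ K] exI[of _ a] conjI ballI impI K UnionI[OF S(1)] KS[rule_format]) simp_all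
  qed
qed

lemma openin_Lp_topology: "openin (Lp_topology P F p) = Lp_open P F p"
  unfolding Lp_topology_def by (rule topology_inverse'[OF istopology_Lp_open])

lemma topspace_Lp_topology: "topspace (Lp_topology P F p) = Lp_martingales P F p"
proof -
  have "Lp_open P F p (Lp_martingales P F p)"
    by (intro Lp_openI subset_refl exI[of _ "{}"] exI[of _ "1::real"]) simp
  moreover have "U \<subseteq> Lp_martingales P F p" if "Lp_open P F p U" for U
    using that by (simp add: Lp_open_def)
  ultimately show ?thesis
    unfolding topspace_def openin_Lp_topology by (intro equalityI Union_least Union_upper) simp_all
qed

definition Lp_martingales_tilde ::
  "'w measure \<Rightarrow> (real \<Rightarrow> 'w measure) \<Rightarrow> real \<Rightarrow> (real \<Rightarrow> 'w \<Rightarrow> complex^'n^'n) set" where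
  "Lp_martingales_tilde P F p = Lp_topology P F p closure_of Linf_martingales P F"

end

theory Submission
  imports Defs
begin

text \<open>A Brownian path has no modulus of continuity that is uniform in \<open>\<omega>\<close>, so \<open>X\<close> is not
\<open>L\<^sup>\<infinity>\<close>-continuous.  The cure is to stop \<open>X\<close> as soon as a prescribed modulus is violated.
Given numbers \<open>\<delta>\<^sub>k > 0\<close> and a horizon \<open>T\<close>, let \<open>\<tau>\<close> be the first time by which two earlier times at
distance less than \<open>\<delta>\<^sub>k\<close> have values more than \<open>1/(k+1)\<close> apart, for some \<open>k\<close>, or \<open>T\<close> if that is
earlier (\<open>modulus_exit\<close>).  The stopped process \<open>N t = X (min t \<tau>)\<close> then satisfies the deterministic
bound \<open>norm (N s - N t) \<le> 1/(k+1)\<close> for \<open>\<bar>s - t\<bar> < \<delta>\<^sub>k\<close>, so it is bounded and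
\<open>L\<^sup>\<infinity>\<close>-continuous (\<open>modulus_exit_modulus\<close>, \<open>matrix_martingale_in_Linf_martingales\<close>).
Because every path is uniformly continuous on \<open>[0, T]\<close>, the \<open>\<delta>\<^sub>k\<close> can be chosen such that
\<open>\<tau> < T\<close> has probability as small as desired (\<open>modulus_exit_late\<close>).

The process \<open>N\<close> is again a martingale, and its even moments do not exceed those of \<open>X\<close>
(\<open>optional_stopping\<close>): replace \<open>\<tau>\<close> by the next point of a finite grid, where both claims are
statements about finitely many martingale increments, and refine the grid; boundedness in \<open>L\<^sup>2\<close> lets
the limit pass through the expectation.  On \<open>[0, T]\<close> the difference \<open>N t - X t\<close> vanishes unless
\<open>\<tau> < T\<close>, and its moments are bounded independently of \<open>\<tau>\<close>; hence its \<open>L\<^sup>p\<close>-norm is small uniformly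
in \<open>t \<le> T\<close> (\<open>matrix_martingale_approximation\<close>).

Only two properties of Brownian motion enter: it is a continuous martingale started at \<open>0\<close>, and all
its moments are finite.  The argument is therefore carried out for the class \<open>matrix_martingale\<close>, and the
Gaussian independent increments serve to show that a Hermitian Brownian motion belongs to it.

The noncommutative \<open>L\<^sup>p\<close>-norm is used only through the function
\<open>A \<mapsto> tr\<^sub>n (\<bar>A\<bar>\<^sup>p)\<close> (\<open>tr_abs_powr\<close>) and three facts about it: it is nonnegative, it is at most
\<open>norm A powr p\<close> for the Frobenius norm, and it is Borel measurable.  These follow from the spectral theorem
for Hermitian matrices.\<close>

section \<open>Diagonalization of Hermitian matrices\<close>

text \<open>A maximizer \<open>v\<close> of the Rayleigh quotient over the unit sphere of \<open>W\<close>, with maximum \<open>l\<close>, makes the form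
\<open>l (w \<bullet> w) - f w \<bullet> w\<close> nonnegative on \<open>W\<close> and zero at \<open>v\<close>.  A nonnegative quadratic form has vanishing
differential at a zero, which says that \<open>f v - l v\<close> is orthogonal to \<open>W\<close>; as this vector lies in \<open>W\<close>,
it is \<open>0\<close>.\<close>

lemma selfadjoint_eigenvector:
  fixes f :: "'a::euclidean_space \<Rightarrow> 'a"
  assumes "linear f" and sym: "\<And>x y. f x \<bullet> y = x \<bullet> f y"
    and W: "subspace W" and inv: "\<And>x. x \<in> W \<Longrightarrow> f x \<in> W" and "\<exists>x\<in>W. x \<noteq> 0"
  obtains v l where "v \<in> W" "norm v = 1" "f v = l *\<^sub>R v"
proof -
  interpret f: linear f by fact
  from assms obtain x where x: "x \<in> W" "x \<noteq> 0" by blast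
  define S where "S = W \<inter> sphere 0 1"
  have "x /\<^sub>R norm x \<in> S"
    using x W by (auto simp: S_def subspace_scale)
  moreover have "compact S"
    unfolding S_def using closed_subspace[OF W] by (intro closed_Int_compact) auto
  moreover have "continuous_on S (\<lambda>v. f v \<bullet> v)"
    using \<open>linear f\<close> by (intro continuous_intros linear_continuous_on linear_conv_bounded_linear[THEN iffD1])
  ultimately obtain v where v: "v \<in> S" "\<And>w. w \<in> S \<Longrightarrow> f w \<bullet> w \<le> f v \<bullet> v"
    using continuous_attains_sup[of S "\<lambda>v. f v \<bullet> v"] by blast
  define l where "l = f v \<bullet> v"
  have vv: "v \<bullet> v = 1" and vW: "v \<in> W" using v(1) by (auto simp: S_def norm_eq_1)
  have pos: "f w \<bullet> w \<le> l * (w \<bullet> w)" if "w \<in> W" for w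
  proof (cases "w = 0")
    case False
    have "w /\<^sub>R norm w \<in> S" using that False W by (auto simp: S_def subspace_scale)
    from v(2)[OF this] have "(f w \<bullet> w) / (norm w)^2 \<le> l"
      by (simp add: f.scale l_def power2_eq_square divide_simps)
    then show ?thesis using False by (simp add: divide_simps dot_square_norm)
  qed (simp add: f.zero)
  \<comment> \<open>The form is evaluated at \<open>v + t w\<close>, which bounds a multiple of \<open>t\<close> by a multiple of \<open>t\<^sup>2\<close>.\<close>
  define w where "w = f v - l *\<^sub>R v"
  have wW: "w \<in> W" unfolding w_def using inv[OF vW] vW W by (intro subspace_diff subspace_scale)
  have fw: "f v \<bullet> w = w \<bullet> w + l * (v \<bullet> w)" by (simp add: w_def inner_diff_left inner_diff_right inner_commute algebra_simps)
  define b where "b = l * (w \<bullet> w) - f w \<bullet> w"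
  have quad: "2 * t * (w \<bullet> w) \<le> t^2 * b" for t
  proof -
    have "v + t *\<^sub>R w \<in> W" using wW vW W by (intro subspace_add subspace_scale)
    moreover have "v \<bullet> f v = l" by (simp add: l_def inner_commute)
    ultimately have "l + 2 * t * (f v \<bullet> w) + t^2 * (f w \<bullet> w)
       \<le> l * (1 + 2 * t * (v \<bullet> w) + t^2 * (w \<bullet> w))"
      using pos[of "v + t *\<^sub>R w"] sym[of w v]
      by (simp add: f.add f.scale inner_add_left inner_add_right vv inner_commute power2_eq_square algebra_simps)
    then show ?thesis unfolding fw b_def by (simp add: algebra_simps power2_eq_square)
  qed
  have "w \<bullet> w = 0"
  proof (rule ccontr)
    assume "w \<bullet> w \<noteq> 0"
    then have ww: "w \<bullet> w > 0" by simp
    define c where "c = max 1 b"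
    have c: "c > 0" "b \<le> c" by (auto simp: c_def)
    have "2 * ((w \<bullet> w)/c) * (w \<bullet> w) \<le> ((w \<bullet> w)/c)^2 * b" by (rule quad)
    also have "\<dots> \<le> ((w \<bullet> w)/c)^2 * c" using c by (intro mult_left_mono) auto
    also have "\<dots> = ((w \<bullet> w)/c) * (w \<bullet> w)" using c by (simp add: power2_eq_square)
    finally have "(w \<bullet> w) * (w \<bullet> w) \<le> 0" using c by (simp add: divide_simps)
    then show False using mult_pos_pos[OF ww ww] by linarith
  qed
  then have "f v = l *\<^sub>R v" by (simp add: w_def)
  with vW v(1) show thesis by (intro that) (auto simp: S_def)
qed

text \<open>The inner product of \<open>complex^'n\<close> in the library is the real one.  Together, \<open>x \<bullet> y\<close> and \<open>x \<bullet> \<i> y\<close> are the real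
and the imaginary part of the Hermitian inner product, so complex orthogonality of \<open>x\<close> to \<open>y\<close> is real orthogonality
of \<open>x\<close> to both \<open>y\<close> and \<open>\<i> y\<close>.\<close>

lemma inner_cvec: "x \<bullet> y = Re (\<Sum>i\<in>UNIV. cnj (y $ i) * x $ i)" for x y :: "complex^'n"
  by (simp add: inner_vec_def inner_complex_def algebra_simps)

lemma inner_cvec_ii: "x \<bullet> (\<i> *s y) = Im (\<Sum>i\<in>UNIV. cnj (y $ i) * x $ i)" for x y :: "complex^'n"
  by (simp add: inner_vec_def inner_complex_def algebra_simps)

lemma hermitian_selfadjoint:
  fixes H :: "complex^'n^'n"
  assumes "hermitian H"
  shows "(H *v x) \<bullet> y = x \<bullet> (H *v y)"
proof -
  have H: "H $ i $ j = cnj (H $ j $ i)" for i j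
    using assms unfolding hermitian_def ctransp_def by (metis (lifting) vec_lambda_beta)
  have "(\<Sum>i\<in>UNIV. cnj (y $ i) * (H *v x) $ i) = (\<Sum>i\<in>UNIV. \<Sum>j\<in>UNIV. cnj (y $ i) * H $ i $ j * x $ j)"
    by (simp add: matrix_vector_mult_def sum_distrib_left mult.assoc)
  also have "\<dots> = (\<Sum>j\<in>UNIV. \<Sum>i\<in>UNIV. cnj (y $ i) * H $ i $ j * x $ j)" by (rule sum.swap)
  also have "\<dots> = (\<Sum>j\<in>UNIV. \<Sum>i\<in>UNIV. cnj (y $ i) * cnj (H $ j $ i) * x $ j)" by (intro sum.cong refl) (subst H, rule refl)
  also have "\<dots> = (\<Sum>j\<in>UNIV. cnj ((H *v y) $ j) * x $ j)"
    by (simp add: matrix_vector_mult_def sum_distrib_right sum_distrib_left mult_ac)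
  finally show ?thesis by (simp add: inner_cvec)
qed

text \<open>The family is extended by one eigenvector at a time: the vectors orthogonal to all \<open>u i\<close> and \<open>\<i> u i\<close>
with \<open>i \<in> S\<close> form an invariant subspace, which is nontrivial because \<open>2 * card S\<close> real conditions cannot
exhaust the real dimension \<open>2 * CARD('n)\<close>.\<close>

lemma hermitian_orthonormal_eigenvectors:
  fixes H :: "complex^'n^'n"
  assumes H: "hermitian H" and "finite (S :: 'n set)"
  shows "\<exists>u d. (\<forall>i\<in>S. H *v u i = d i *\<^sub>R u i) \<and>
    (\<forall>i\<in>S. \<forall>j\<in>S. u j \<bullet> u i = (if i = j then 1 else 0) \<and> u j \<bullet> (\<i> *s u i) = 0)"
  using \<open>finite S\<close>
proof (induction S)
  case (insert k S)
  then obtain u d where u: "\<And>i. i \<in> S \<Longrightarrow> H *v u i = d i *\<^sub>R u i"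
    and on: "\<And>i j. i \<in> S \<Longrightarrow> j \<in> S \<Longrightarrow> u j \<bullet> u i = (if i = j then 1 else 0) \<and> u j \<bullet> (\<i> *s u i) = 0"
    by blast
  define B where "B = u ` S \<union> (\<lambda>i. \<i> *s u i) ` S"
  define W where "W = {v. \<forall>b\<in>B. v \<bullet> b = 0}"
  have "card B \<le> 2 * card S"
    unfolding B_def using card_Un_le[of "u ` S" "(\<lambda>i. \<i> *s u i) ` S"]
      card_image_le[OF \<open>finite S\<close>, of u] card_image_le[OF \<open>finite S\<close>, of "\<lambda>i. \<i> *s u i"] by linarith
  moreover have "card S < CARD('n)"
    using insert.hyps by (intro psubset_card_mono) auto
  moreover have "dim (span B) \<le> card B" unfolding dim_span
    using \<open>finite S\<close> by (intro dim_le_card') (auto simp: B_def)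
  ultimately have "dim (span B) < DIM(complex^'n)" by simp
  then obtain x where x: "x \<noteq> 0" "\<And>y. y \<in> span B \<Longrightarrow> orthogonal x y"
    using orthogonal_to_subspace_exists[of B] by (auto simp: dim_span)
  have xW: "x \<in> W" using x(2) by (auto simp: W_def orthogonal_def span_base)
  have subW: "subspace W" by (auto simp: W_def subspace_def inner_add_left)
  have lin: "linear ((*v) H)"
    by (rule linearI) (simp_all add: matrix_vector_right_distrib vec_eq_iff matrix_vector_mult_def sum_distrib_left scaleR_right.sum sum.distrib distrib_left)
  have HB: "v \<bullet> (H *v b) = 0" if "v \<in> W" "b \<in> B" for v b
  proof -
    from that(2) consider i where "i \<in> S" "b = u i" | i where "i \<in> S" "b = \<i> *s u i" unfolding B_def by blast
    then show ?thesis
    proof cases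
      case 1 with that u show ?thesis by (auto simp: W_def)
    next
      case 2
      have "H *v b = d i *\<^sub>R b"
        by (simp add: 2 vector_scalar_commute u[OF 2(1)] vec_eq_iff scaleR_conv_of_real)
      with that 2 show ?thesis by (auto simp: W_def)
    qed
  qed
  obtain v l where v: "v \<in> W" "norm v = 1" "H *v v = l *\<^sub>R v"
  proof (rule selfadjoint_eigenvector[OF lin hermitian_selfadjoint[OF H] subW])
    show "H *v w \<in> W" if "w \<in> W" for w
      using HB[OF that] by (simp add: W_def hermitian_selfadjoint[OF H])
    show "\<exists>w\<in>W. w \<noteq> 0" using xW x(1) by blast
  qed
  have ortho: "v \<bullet> u i = 0" "v \<bullet> (\<i> *s u i) = 0" "u i \<bullet> v = 0" "u i \<bullet> (\<i> *s v) = 0" if "i \<in> S" for i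
  proof -
    show 1: "v \<bullet> u i = 0" "v \<bullet> (\<i> *s u i) = 0" using v(1) that by (auto simp: W_def B_def)
    then show "u i \<bullet> v = 0" by (simp add: inner_commute)
    from 1(2) show "u i \<bullet> (\<i> *s v) = 0" 
      by (simp add: inner_vec_def inner_complex_def sum.distrib sum_subtractf mult.commute)
  qed
  have vv: "v \<bullet> v = 1" "v \<bullet> (\<i> *s v) = 0" using v(2) 
    by (simp_all add: norm_eq_1 inner_vec_def inner_complex_def mult.commute)
  define u' where "u' = u(k := v)"
  define d' where "d' = d(k := l)"
  have e1: "H *v u' i = d' i *\<^sub>R u' i" if "i \<in> insert k S" for i
    using that u v(3) by (cases "i = k") (simp_all add: u'_def d'_def)
  have e2: "u' j \<bullet> u' i = (if i = j then 1 else 0) \<and> u' j \<bullet> (\<i> *s u' i) = 0"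
    if "i \<in> insert k S" "j \<in> insert k S" for i j
  proof (cases "i = k")
    case True
    then show ?thesis using that ortho(3,4)[of j] vv by (cases "j = k") (simp_all add: u'_def)
  next
    case False
    then show ?thesis using that ortho(1,2)[of i] on[of i j] by (cases "j = k") (simp_all add: u'_def)
  qed
  have "\<forall>i\<in>insert k S. H *v u' i = d' i *\<^sub>R u' i" by (rule ballI) (rule e1)
  moreover have "\<forall>i\<in>insert k S. \<forall>j\<in>insert k S. u' j \<bullet> u' i = (if i = j then 1 else 0) \<and> u' j \<bullet> (\<i> *s u' i) = 0"
    by (intro ballI) (rule e2)
  ultimately show ?case by (intro exI[of _ u'] exI[of _ d']) (rule conjI)
qed simp

lemma hermitian_diagonalizable:
  fixes H :: "complex^'n^'n"
  assumes "hermitian H"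
  obtains U d where "unitary U" "H = U ** diag d ** ctransp U"
proof -
  obtain u :: "'n \<Rightarrow> _" and d where *: "\<forall>i\<in>UNIV. H *v u i = d i *\<^sub>R u i"
    "\<forall>i\<in>UNIV. \<forall>j\<in>UNIV. u j \<bullet> u i = (if i = j then 1 else 0) \<and> u j \<bullet> (\<i> *s u i) = 0"
    using hermitian_orthonormal_eigenvectors[OF assms finite[of UNIV]] by blast
  then have u: "\<And>i. H *v u i = d i *\<^sub>R u i"
    and on: "\<And>i j. u j \<bullet> u i = (if i = j then 1 else 0) \<and> u j \<bullet> (\<i> *s u i) = 0"
    by simp_all
  define U :: "complex^'n^'n" where "U = (\<chi> i j. u j $ i)"
  have "(\<Sum>k\<in>UNIV. cnj (u i $ k) * u j $ k) = (if i = j then 1 else 0)" for i j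
    using on[of j i] unfolding inner_cvec_ii unfolding inner_cvec by (intro complex_eqI) auto
  then have 1: "ctransp U ** U = mat 1"
    by (simp add: vec_eq_iff matrix_matrix_mult_def ctransp_def U_def mat_def)
  then have 2: "U ** ctransp U = mat 1" by (simp add: matrix_left_right_inverse)
  have "(\<Sum>k\<in>UNIV. H $ i $ k * u j $ k) = complex_of_real (d j) * u j $ i" for i j
  proof -
    have "(H *v u j) $ i = (d j *\<^sub>R u j) $ i" by (simp only: u)
    then show ?thesis unfolding matrix_vector_mult_def vector_scaleR_component by (simp add: scaleR_conv_of_real)
  qed
  then have "H ** U = U ** diag d"
    by (simp add: vec_eq_iff matrix_matrix_mult_def diag_def U_def mult_delta_right mult.commute if_distrib sum.delta cong: if_cong)
  then have "H = U ** diag d ** ctransp U"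
    by (metis 2 matrix_mul_assoc matrix_mul_rid)
  with 1 2 show thesis by (intro that) (auto simp: unitary_def)
qed

lemma matrix_mult_diag_right: "(A ** diag d) $ i $ j = A $ i $ j * of_real (d j)"
  by (simp add: matrix_matrix_mult_def diag_def if_distrib sum.delta cong: if_cong)

lemma matrix_mult_diag_left: "(diag d ** A) $ i $ j = of_real (d i) * A $ i $ j"
  by (simp add: matrix_matrix_mult_def diag_def if_distrib if_distribR sum.delta cong: if_cong)

text \<open>Independence of the diagonalization: if \<open>U D U\<^sup>* = V E V\<^sup>*\<close>, then \<open>W = V\<^sup>* U\<close> intertwines \<open>D\<close> and \<open>E\<close>,
so an entry \<open>W\<^sub>i\<^sub>j\<close> can be nonzero only where \<open>d\<^sub>j = e\<^sub>i\<close>; hence \<open>W\<close> intertwines \<open>f(D)\<close> and \<open>f(E)\<close> too.\<close>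

lemma hermitian_fun_eq:
  fixes U :: "complex^'n^'n"
  assumes U: "unitary U"
  shows "hermitian_fun f (U ** diag d ** ctransp U) = U ** diag (\<lambda>i. f (d i)) ** ctransp U"
  unfolding hermitian_fun_def
proof (rule the_equality)
  fix B assume "\<exists>V e. unitary V \<and> U ** diag d ** ctransp U = V ** diag e ** ctransp V
       \<and> B = V ** diag (\<lambda>i. f (e i)) ** ctransp V"
  then obtain V e where V: "unitary V" and eq: "U ** diag d ** ctransp U = V ** diag e ** ctransp V"
    and B: "B = V ** diag (\<lambda>i. f (e i)) ** ctransp V" by blast
  define W where "W = ctransp V ** U"
  have UW: "U = V ** W" using V by (simp add: W_def matrix_mul_assoc unitary_def)
  have WV: "ctransp V = W ** ctransp U" using U by (simp add: W_def matrix_mul_assoc[symmetric] unitary_def)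
  have "W ** diag d = ctransp V ** (U ** diag d ** ctransp U) ** U"
    using U by (simp add: W_def matrix_mul_assoc[symmetric] unitary_def)
  also have "\<dots> = diag e ** W"
    unfolding eq using V by (simp add: W_def matrix_mul_assoc unitary_def)
  finally have *: "W $ i $ j * of_real (d j) = of_real (e i) * W $ i $ j" for i j
    by (metis matrix_mult_diag_left matrix_mult_diag_right)
  have "W $ i $ j * of_real (f (d j)) = of_real (f (e i)) * W $ i $ j" for i j
    using *[of i j] by (cases "W $ i $ j = 0") (auto simp: mult.commute)
  then have "W ** diag (\<lambda>i. f (d i)) = diag (\<lambda>i. f (e i)) ** W"
    by (simp add: vec_eq_iff matrix_mult_diag_left matrix_mult_diag_right)
  then show "B = U ** diag (\<lambda>i. f (d i)) ** ctransp U"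
    unfolding B using UW WV by (metis matrix_mul_assoc)
qed (use U in blast)

lemma trace_unitary_conj:
  fixes U :: "complex^'n^'n"
  assumes "unitary U"
  shows "trace (U ** diag d ** ctransp U) = of_real (\<Sum>i\<in>UNIV. d i)"
proof -
  have "trace (U ** diag d ** ctransp U) = trace (ctransp U ** (U ** diag d))"
    by (rule trace_mul_sym)
  also have "\<dots> = trace (diag d)"
    using assms by (simp add: matrix_mul_assoc unitary_def)
  finally show ?thesis by (simp add: trace_def diag_def)
qed

lemma norm_matrix_vector_mult_le: "norm (A *v x) \<le> norm A * norm x" for A :: "complex^'n^'m"
proof -
  have "norm ((A *v x) $ i) \<le> norm (A $ i) * norm x" for i
  proof -
    have "norm ((A *v x) $ i) \<le> (\<Sum>j\<in>UNIV. \<bar>norm (A $ i $ j)\<bar> * \<bar>norm (x $ j)\<bar>)"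
      unfolding matrix_vector_mult_def by (auto intro!: order_trans[OF norm_sum] simp: norm_mult)
    also have "\<dots> \<le> norm (A $ i) * norm x" unfolding norm_vec_def by (rule L2_set_mult_ineq)
    finally show ?thesis .
  qed
  then have "norm (A *v x) \<le> L2_set (\<lambda>i. norm (A $ i) * norm x) UNIV"
    unfolding norm_vec_def[of "A *v x"] by (intro L2_set_mono) auto
  then show ?thesis by (simp add: L2_set_left_distrib[symmetric] norm_vec_def[of A])
qed

lemma mat_opnorm_le: "mat_opnorm A \<le> norm A"
  unfolding mat_opnorm_def by (intro onorm_bound norm_matrix_vector_mult_le norm_ge_zero)

section \<open>The normalized trace of the powers of the absolute value\<close>

definition tr_abs_powr :: "real \<Rightarrow> complex^'n^'n \<Rightarrow> real" where
  "tr_abs_powr p A = Re (ntrace (mat_powr (mat_abs A) p))"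

text \<open>The eigenvalue of \<open>A\<^sup>* A\<close> at a unit eigenvector \<open>u\<close> is \<open>norm (A u) ^ 2\<close>, which gives both bounds on \<open>d\<close>.\<close>

lemma tr_abs_powr_diagonal:
  fixes A :: "complex^'n^'n"
  obtains U d where "unitary U" "ctransp A ** A = U ** diag d ** ctransp U"
    "\<And>i. 0 \<le> d i" "\<And>i. d i \<le> (norm A)\<^sup>2"
    "\<And>p. tr_abs_powr p A = (\<Sum>i\<in>UNIV. sqrt (d i) powr p) / CARD('n)"
proof -
  have "hermitian (ctransp A ** A)"
    by (simp add: hermitian_def ctransp_def matrix_matrix_mult_def vec_eq_iff mult.commute)
  then obtain U d where U: "unitary U" and eq: "ctransp A ** A = U ** diag d ** ctransp U"
    using hermitian_diagonalizable by blast
  have "ctransp U ** (ctransp A ** A) ** U = diag d"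
    unfolding eq using U by (metis matrix_mul_assoc matrix_mul_lid matrix_mul_rid unitary_def)
  moreover have "ctransp U ** (ctransp A ** A) ** U = ctransp (A ** U) ** (A ** U)"
  proof -
    have "ctransp (A ** U) = ctransp U ** ctransp A"
      by (simp add: vec_eq_iff ctransp_def matrix_matrix_mult_def mult.commute)
    then show ?thesis by (simp add: matrix_mul_assoc)
  qed
  ultimately have *: "(ctransp (A ** U) ** (A ** U)) $ i $ i = of_real (d i)" for i
    by (simp add: diag_def)
  have sq: "(ctransp B ** B) $ i $ i = of_real ((norm (column i B))\<^sup>2)" for B :: "complex^'n^'n" and i
    by (simp add: ctransp_def matrix_matrix_mult_def norm_vec_def L2_set_def column_def sum_nonneg
        complex_norm_square[symmetric] mult.commute flip: of_real_power)
  have d: "d i = (norm (A *v column i U))\<^sup>2" for i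
    using *[of i] unfolding sq of_real_eq_iff by (simp add: matrix_vector_mult_def column_def matrix_matrix_mult_def)
  have colU: "norm (column i U) = 1" for i
  proof -
    have "(ctransp U ** U) $ i $ i = 1" using U by (simp add: unitary_def mat_def)
    then have "(norm (column i U))\<^sup>2 = 1" unfolding sq by (metis of_real_eq_1_iff)
    then show ?thesis by (intro power2_eq_imp_eq[where y = 1]) auto
  qed
  show thesis
  proof (rule that[OF U eq])
    show "0 \<le> d i" for i by (simp add: d)
    show "d i \<le> (norm A)\<^sup>2" for i
      unfolding d using norm_matrix_vector_mult_le[of A "column i U"] by (intro power_mono) (auto simp: colU)
    show "tr_abs_powr p A = (\<Sum>i\<in>UNIV. sqrt (d i) powr p) / CARD('n)" for p
      by (simp add: tr_abs_powr_def mat_powr_def mat_abs_def eq hermitian_fun_eq[OF U] ntrace_def trace_unitary_conj[OF U])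
  qed
qed

lemma tr_abs_powr_nonneg: "0 \<le> tr_abs_powr p A"
  using tr_abs_powr_diagonal[of A] by (metis divide_nonneg_nonneg of_nat_0_le_iff powr_ge_zero sum_nonneg)

lemma tr_abs_powr_le:
  fixes A :: "complex^'n^'n"
  assumes "0 \<le> p"
  shows "tr_abs_powr p A \<le> norm A powr p"
proof -
  obtain d :: "'n \<Rightarrow> real" where d: "\<And>i. 0 \<le> d i" "\<And>i. d i \<le> (norm A)\<^sup>2"
    "\<And>p. tr_abs_powr p A = (\<Sum>i\<in>UNIV. sqrt (d i) powr p) / CARD('n)"
    using tr_abs_powr_diagonal[of A] by metis
  have "sqrt (d i) powr p \<le> norm A powr p" for i
    using d(1,2)[of i] assms by (intro powr_mono2) (auto simp: real_le_lsqrt)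
  then have "(\<Sum>i\<in>UNIV. sqrt (d i) powr p) \<le> (\<Sum>i\<in>(UNIV::'n set). norm A powr p)" by (intro sum_mono)
  then show ?thesis by (simp add: d(3) divide_simps mult.commute)
qed

lemma continuous_on_matrix_mult [continuous_intros]:
  fixes f g :: "'a::topological_space \<Rightarrow> complex^'n^'n"
  assumes "continuous_on S f" "continuous_on S g"
  shows "continuous_on S (\<lambda>x. f x ** g x)"
  unfolding matrix_matrix_mult_def
  by (intro continuous_on_vec_lambda continuous_intros assms)

lemma continuous_on_ctransp [continuous_intros]:
  assumes "continuous_on S f"
  shows "continuous_on S (\<lambda>x. ctransp (f x))"
  unfolding ctransp_def by (intro continuous_on_vec_lambda continuous_intros assms)

lemma unitary_conj_power:
  assumes "unitary U" "H = U ** diag d ** ctransp U"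
  shows "((\<lambda>B. H ** B) ^^ k) (mat 1) = U ** diag (\<lambda>i. d i ^ k) ** ctransp U"
proof (induction k)
  case 0
  have "diag (\<lambda>i. d i ^ 0) = mat 1" by (simp add: diag_def mat_def vec_eq_iff)
  then show ?case using assms(1) by (simp only: unitary_def funpow_0 matrix_mul_rid)
next
  case (Suc k)
  have "diag d ** diag (\<lambda>i. d i ^ k) = diag (\<lambda>i. d i * d i ^ k)"
    by (simp add: vec_eq_iff matrix_mult_diag_left) (simp add: diag_def)
  then have *: "diag d ** (diag (\<lambda>i. d i ^ k) ** ctransp U) = diag (\<lambda>i. d i ^ Suc k) ** ctransp U"
    by (simp add: matrix_mul_assoc)
  have "((\<lambda>B. H ** B) ^^ Suc k) (mat 1) = H ** (U ** diag (\<lambda>i. d i ^ k) ** ctransp U)"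
    by (simp add: Suc)
  also have "\<dots> = U ** (diag d ** ((ctransp U ** U) ** (diag (\<lambda>i. d i ^ k) ** ctransp U)))"
    by (simp only: assms(2) matrix_mul_assoc)
  also have "\<dots> = U ** diag (\<lambda>i. d i ^ Suc k) ** ctransp U"
    using assms(1) * by (simp only: unitary_def matrix_mul_lid matrix_mul_assoc)
  finally show ?case .
qed

text \<open>For a polynomial \<open>g\<close>, the number \<open>tr\<^sub>n (g (A\<^sup>* A))\<close> is a continuous function of \<open>A\<close>.
Polynomials that approximate \<open>x \<mapsto> sqrt x powr p\<close> uniformly on \<open>[0, m]\<close> within \<open>1/(m+1)\<close> exhibit
\<open>tr_abs_powr p\<close> as a pointwise limit of such functions.\<close>

lemma tr_abs_powr_borel [measurable]:
  assumes "0 < p"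
  shows "tr_abs_powr p \<in> borel_measurable (borel :: (complex^'n^'n) measure)"
proof -
  define f where "f x = sqrt x powr p" for x :: real
  have "\<exists>g. real_polynomial_function g \<and> (\<forall>x\<in>{0..real m}. \<bar>f x - g x\<bar> < 1 / Suc m)" for m
  proof -
    have "continuous_on {0..real m} f" unfolding f_def
      using assms by (intro continuous_on_powr'[OF continuous_on_real_sqrt[OF continuous_on_id] continuous_on_const]) auto
    then obtain g where "real_polynomial_function g" "\<And>x. x \<in> {0..real m} \<Longrightarrow> \<bar>f x - g x\<bar> < 1 / Suc m"
      by (rule Stone_Weierstrass_real_polynomial_function[OF compact_Icc, of _ _ _ "1 / Suc m"]) simp_all
    then show ?thesis by blast
  qed
  then obtain g where g: "\<And>m. real_polynomial_function (g m)"
    "\<And>m x. x \<in> {0..real m} \<Longrightarrow> \<bar>f x - g m x\<bar> < 1 / Suc m" by metis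
  then obtain a N where aN: "\<And>m. g m = (\<lambda>x. \<Sum>k\<le>N m. a m k * x ^ k)"
    unfolding real_polynomial_function_iff_sum by metis
  define T where "T m A = (\<Sum>k\<le>N m. a m k * Re (ntrace (((\<lambda>B. (ctransp A ** A) ** B) ^^ k) (mat 1))))"
    for m and A :: "complex^'n^'n"
  have "continuous_on UNIV (\<lambda>A::complex^'n^'n. ((\<lambda>B. (ctransp A ** A) ** B) ^^ k) (mat 1))" for k
    by (induction k) (auto intro!: continuous_intros)
  then have "continuous_on UNIV (T m)" for m
    unfolding T_def ntrace_def trace_def by (intro continuous_intros) auto
  then have meas: "T m \<in> borel_measurable borel" for m by (rule borel_measurable_continuous_onI)
  have lim: "(\<lambda>m. T m A) \<longlonglongrightarrow> tr_abs_powr p A" for A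
  proof -
    obtain U and d :: "'n \<Rightarrow> real" where d: "unitary U" "ctransp A ** A = U ** diag d ** ctransp U"
      "\<And>i. 0 \<le> d i" "\<And>i. d i \<le> (norm A)\<^sup>2"
      "\<And>p. tr_abs_powr p A = (\<Sum>i\<in>UNIV. sqrt (d i) powr p) / CARD('n)"
      using tr_abs_powr_diagonal[of A] by metis
    have T: "T m A = (\<Sum>i\<in>UNIV. g m (d i)) / CARD('n)" for m
      unfolding T_def unitary_conj_power[OF d(1,2)] ntrace_def trace_unitary_conj[OF d(1)] aN
      by (subst sum.swap) (simp add: sum_divide_distrib sum_distrib_left)
    have "(\<lambda>m. g m (d i)) \<longlonglongrightarrow> f (d i)" for i
    proof (rule LIM_zero_cancel, rule Lim_null_comparison)
      show "\<forall>\<^sub>F m in sequentially. norm (g m (d i) - f (d i)) \<le> 1 / Suc m"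
        using eventually_ge_at_top[of "nat \<lceil>d i\<rceil>"]
      proof eventually_elim
        case (elim m)
        then show ?case using g(2)[of "d i" m] d(3)[of i] by (auto simp: abs_minus_commute nat_le_iff ceiling_le_iff)
      qed
    qed (rule LIMSEQ_Suc[OF lim_1_over_n])
    then show ?thesis unfolding T d(5) f_def[symmetric] by (intro tendsto_intros) auto
  qed
  show ?thesis by (rule borel_measurable_LIMSEQ_real[OF lim meas])
qed

section \<open>Random variables with finite moments\<close>

definition has_moments :: "'w measure \<Rightarrow> ('w \<Rightarrow> real) \<Rightarrow> bool" where
  "has_moments P f \<longleftrightarrow> f \<in> borel_measurable P \<and> (\<forall>k. integrable P (\<lambda>\<omega>. f \<omega> ^ k))"

lemma has_momentsD:
  assumes "has_moments P f"
  shows "f \<in> borel_measurable P" "integrable P (\<lambda>\<omega>. f \<omega> ^ k)" "integrable P f"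
    "integrable P (\<lambda>\<omega>. \<bar>f \<omega>\<bar> ^ k)"
proof -
  show "f \<in> borel_measurable P" "integrable P (\<lambda>\<omega>. f \<omega> ^ k)" for k
    using assms by (auto simp: has_moments_def)
  from this(2)[of 1] this(2)[of k, THEN integrable_abs]
  show "integrable P f" "integrable P (\<lambda>\<omega>. \<bar>f \<omega>\<bar> ^ k)" by (simp_all add: power_abs)
qed

lemma add_power_le: "(x + y) ^ k \<le> 2 ^ k * (x ^ k + y ^ k)" if "0 \<le> x" "0 \<le> y" for x y :: real
proof -
  have "(x + y) ^ k \<le> (2 * max x y) ^ k" using that by (intro power_mono) auto
  also have "\<dots> = 2 ^ k * (max x y) ^ k" by (rule power_mult_distrib)
  also have "(max x y) ^ k \<le> x ^ k + y ^ k" using that by (simp add: max_def)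
  finally show ?thesis by simp
qed

lemma has_moments_dominated:
  assumes g: "has_moments P g" and h: "has_moments P h" and [measurable]: "f \<in> borel_measurable P"
    and le: "AE \<omega> in P. \<bar>f \<omega>\<bar> \<le> \<bar>g \<omega>\<bar> + \<bar>h \<omega>\<bar>"
  shows "has_moments P f"
  unfolding has_moments_def
proof (intro conjI allI)
  fix k
  have "integrable P (\<lambda>\<omega>. 2 ^ k * (\<bar>g \<omega>\<bar> ^ k + \<bar>h \<omega>\<bar> ^ k))"
    using has_momentsD(4)[OF g] has_momentsD(4)[OF h] by simp
  then show "integrable P (\<lambda>\<omega>. f \<omega> ^ k)"
  proof (rule Bochner_Integration.integrable_bound)
    show "AE \<omega> in P. norm (f \<omega> ^ k) \<le> norm (2 ^ k * (\<bar>g \<omega>\<bar> ^ k + \<bar>h \<omega>\<bar> ^ k))"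
      using le
    proof eventually_elim
      case (elim \<omega>)
      then have "\<bar>f \<omega>\<bar> ^ k \<le> (\<bar>g \<omega>\<bar> + \<bar>h \<omega>\<bar>) ^ k" by (intro power_mono) auto
      also have "\<dots> \<le> 2 ^ k * (\<bar>g \<omega>\<bar> ^ k + \<bar>h \<omega>\<bar> ^ k)" by (intro add_power_le) auto
      finally show ?case by (simp add: power_abs)
    qed
  qed measurable
qed fact

lemma integrable_mult_square:
  fixes f g :: "'w \<Rightarrow> real"
  assumes [measurable]: "f \<in> borel_measurable P" "g \<in> borel_measurable P"
    and "integrable P (\<lambda>\<omega>. f \<omega> ^ 2)" "integrable P (\<lambda>\<omega>. g \<omega> ^ 2)"
  shows "integrable P (\<lambda>\<omega>. f \<omega> * g \<omega>)"
proof (rule Bochner_Integration.integrable_bound)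
  show "integrable P (\<lambda>\<omega>. f \<omega> ^ 2 + g \<omega> ^ 2)" using assms by simp
  show "AE \<omega> in P. norm (f \<omega> * g \<omega>) \<le> norm (f \<omega> ^ 2 + g \<omega> ^ 2)"
  proof (rule AE_I2)
    fix \<omega>
    have "2 * (\<bar>f \<omega>\<bar> * \<bar>g \<omega>\<bar>) \<le> f \<omega> ^ 2 + g \<omega> ^ 2"
      using sum_squares_bound[of "\<bar>f \<omega>\<bar>" "\<bar>g \<omega>\<bar>"] by (simp add: power2_eq_square)
    moreover have "0 \<le> \<bar>f \<omega>\<bar> * \<bar>g \<omega>\<bar>" by simp
    ultimately have "\<bar>f \<omega>\<bar> * \<bar>g \<omega>\<bar> \<le> f \<omega> ^ 2 + g \<omega> ^ 2" by linarith
    then show "norm (f \<omega> * g \<omega>) \<le> norm (f \<omega> ^ 2 + g \<omega> ^ 2)"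
      by (simp only: real_norm_def abs_mult)
  qed
qed measurable

text \<open>Fatou's lemma in the form in which it transfers a bound on moments to a limit.\<close>

lemma Fatou_integrable:
  fixes g :: "nat \<Rightarrow> 'w \<Rightarrow> real"
  assumes lim: "AE \<omega> in P. (\<lambda>m. g m \<omega>) \<longlonglongrightarrow> f \<omega>" and f: "f \<in> borel_measurable P"
    and g: "\<And>m. integrable P (g m)" "\<And>m \<omega>. 0 \<le> g m \<omega>" "\<And>m. (\<integral>\<omega>. g m \<omega> \<partial>P) \<le> C"
  shows "integrable P f" "(\<integral>\<omega>. f \<omega> \<partial>P) \<le> C"
proof -
  note [measurable] = f borel_measurable_integrable[OF g(1)]
  have nn: "AE \<omega> in P. 0 \<le> f \<omega>"
    using lim by eventually_elim (use g(2) in \<open>auto intro: LIMSEQ_le_const\<close>)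
  have C: "0 \<le> C" using g(3)[of 0] integral_nonneg_AE[of "g 0" P] g(2) by (meson AE_I2 order_trans)
  have "(\<integral>\<^sup>+\<omega>. ennreal (f \<omega>) \<partial>P) = (\<integral>\<^sup>+\<omega>. liminf (\<lambda>m. ennreal (g m \<omega>)) \<partial>P)"
    by (rule nn_integral_cong_AE, use lim in eventually_elim)
       (metis lim_imp_Liminf tendsto_ennrealI trivial_limit_sequentially)
  also have "\<dots> \<le> liminf (\<lambda>m. \<integral>\<^sup>+\<omega>. ennreal (g m \<omega>) \<partial>P)"
    by (intro nn_integral_liminf) measurable
  also have "\<dots> = liminf (\<lambda>m. ennreal (\<integral>\<omega>. g m \<omega> \<partial>P))"
    using g by (simp add: nn_integral_eq_integral)
  also have "\<dots> \<le> ennreal C"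
    using g(3) C by (intro Liminf_le) (auto intro!: always_eventually)
  finally have *: "(\<integral>\<^sup>+\<omega>. ennreal (f \<omega>) \<partial>P) \<le> ennreal C" .
  then show i: "integrable P f" using nn f by (intro integrableI_nonneg) (auto intro: le_less_trans)
  show "(\<integral>\<omega>. f \<omega> \<partial>P) \<le> C"
    using * nn_integral_eq_integral[OF i nn] C by (simp add: )
qed

context prob_space
begin

text \<open>Where \<open>h\<close> exceeds \<open>K\<close> it is at most \<open>h\<^sup>2 / K\<close>.  The estimate serves twice: for convergence in \<open>L\<^sup>1\<close> of
sequences bounded in \<open>L\<^sup>2\<close>, and for the smallness of a variable that vanishes off a small event.\<close>

lemma expectation_truncation_le:
  fixes h :: "'a \<Rightarrow> real"
  assumes h: "h \<in> borel_measurable M" "integrable M (\<lambda>\<omega>. h \<omega> ^ 2)" "\<And>\<omega>. 0 \<le> h \<omega>"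
    and "(\<integral>\<omega>. h \<omega> ^ 2 \<partial>M) \<le> C" and "0 < K"
  shows "integrable M h" "(\<integral>\<omega>. h \<omega> \<partial>M) \<le> (\<integral>\<omega>. min (h \<omega>) K \<partial>M) + C / K"
proof -
  note [measurable] = h(1)
  have [simp]: "integrable M (\<lambda>\<omega>. min (h \<omega>) K)"
    using h(3) \<open>0 < K\<close> by (intro integrable_const_bound[of _ K]) (auto simp: min_def)
  have le: "h \<omega> \<le> min (h \<omega>) K + h \<omega> ^ 2 / K" for \<omega>
  proof (cases "h \<omega> \<le> K")
    case False
    then have "h \<omega> * K \<le> h \<omega> * h \<omega>" using h(3)[of \<omega>] by (intro mult_left_mono) auto
    then have "h \<omega> \<le> h \<omega> ^ 2 / K" using \<open>0 < K\<close> by (simp add: power2_eq_square pos_le_divide_eq)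
    then show ?thesis using \<open>0 < K\<close> False by simp
  qed (use \<open>0 < K\<close> in simp)
  show i: "integrable M h"
  proof (rule Bochner_Integration.integrable_bound)
    show "integrable M (\<lambda>\<omega>. min (h \<omega>) K + h \<omega> ^ 2 / K)" using h(2) by simp
    show "AE \<omega> in M. norm (h \<omega>) \<le> norm (min (h \<omega>) K + h \<omega> ^ 2 / K)"
      using le h(3) by (intro AE_I2) (smt (verit) real_norm_def)
  qed measurable
  have "(\<integral>\<omega>. h \<omega> \<partial>M) \<le> (\<integral>\<omega>. min (h \<omega>) K + h \<omega> ^ 2 / K \<partial>M)"
    using i h(2) le by (intro integral_mono) auto
  also have "\<dots> = (\<integral>\<omega>. min (h \<omega>) K \<partial>M) + (\<integral>\<omega>. h \<omega> ^ 2 \<partial>M) / K"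
    using h(2) by simp
  also have "\<dots> \<le> (\<integral>\<omega>. min (h \<omega>) K \<partial>M) + C / K"
    using assms by (intro add_left_mono divide_right_mono) auto
  finally show "(\<integral>\<omega>. h \<omega> \<partial>M) \<le> (\<integral>\<omega>. min (h \<omega>) K \<partial>M) + C / K" .
qed

lemma L1_convergence_of_bounded_square:
  fixes h :: "nat \<Rightarrow> 'a \<Rightarrow> real"
  assumes h: "\<And>m. h m \<in> borel_measurable M" "\<And>m. integrable M (\<lambda>\<omega>. h m \<omega> ^ 2)" "\<And>m \<omega>. 0 \<le> h m \<omega>"
    and C: "\<And>m. (\<integral>\<omega>. h m \<omega> ^ 2 \<partial>M) \<le> C" and lim: "AE \<omega> in M. (\<lambda>m. h m \<omega>) \<longlonglongrightarrow> 0"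
  shows "(\<lambda>m. \<integral>\<omega>. h m \<omega> \<partial>M) \<longlonglongrightarrow> 0"
proof (rule LIMSEQ_I)
  fix e :: real assume "0 < e"
  have C0: "0 \<le> C" using C[of 0] integral_nonneg_AE[of "\<lambda>\<omega>. h 0 \<omega> ^ 2" M] by (meson AE_I2 order_trans zero_le_power2)
  define K where "K = 2 * C / e + 1"
  have K: "0 < K" using C0 \<open>0 < e\<close> by (simp add: K_def add_nonneg_pos)
  have CK: "C / K < e / 2" using C0 \<open>0 < e\<close> K unfolding K_def by (simp add: field_simps)
  note [measurable] = h(1)
  have "(\<lambda>m. \<integral>\<omega>. min (h m \<omega>) K \<partial>M) \<longlonglongrightarrow> (\<integral>\<omega>. 0 \<partial>M)"
  proof (rule integral_dominated_convergence[where w = "\<lambda>_. K"])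
    show "AE \<omega> in M. (\<lambda>m. min (h m \<omega>) K) \<longlonglongrightarrow> 0"
      using lim
    proof eventually_elim
      case (elim \<omega>)
      from tendsto_min[OF elim tendsto_const[of K]] show ?case using K by (simp add: min_def)
    qed
    show "AE \<omega> in M. norm (min (h m \<omega>) K) \<le> K" for m using h(3)[of m] K by (auto simp: min_def)
  qed auto
  then have "eventually (\<lambda>m. (\<integral>\<omega>. min (h m \<omega>) K \<partial>M) < e / 2) sequentially"
    using \<open>0 < e\<close> by (intro order_tendstoD(2)[where y = 0]) auto
  then obtain N where N: "\<And>m. m \<ge> N \<Longrightarrow> (\<integral>\<omega>. min (h m \<omega>) K \<partial>M) < e / 2"
    by (auto simp: eventually_sequentially)
  show "\<exists>N. \<forall>m\<ge>N. norm ((\<integral>\<omega>. h m \<omega> \<partial>M) - 0) < e"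
  proof (intro exI allI impI)
    fix m assume "m \<ge> N"
    have "(\<integral>\<omega>. h m \<omega> \<partial>M) < e"
      using expectation_truncation_le(2)[OF h(1-3) C K, of m] N[OF \<open>m \<ge> N\<close>] CK by linarith
    moreover have "0 \<le> (\<integral>\<omega>. h m \<omega> \<partial>M)" using h(3) by (intro integral_nonneg_AE) auto
    ultimately show "norm ((\<integral>\<omega>. h m \<omega> \<partial>M) - 0) < e" by simp
  qed
qed

lemma set_integral_limit_of_bounded_square:
  fixes f :: "nat \<Rightarrow> 'a \<Rightarrow> real"
  assumes f: "\<And>m. f m \<in> borel_measurable M" "\<And>m. integrable M (\<lambda>\<omega>. f m \<omega> ^ 2)"
    and C: "\<And>m. (\<integral>\<omega>. f m \<omega> ^ 2 \<partial>M) \<le> C"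
    and lim: "AE \<omega> in M. (\<lambda>m. f m \<omega>) \<longlonglongrightarrow> g \<omega>" and g: "g \<in> borel_measurable M"
    and A: "A \<in> sets M"
  shows "(\<lambda>m. \<integral>\<omega>\<in>A. f m \<omega> \<partial>M) \<longlonglongrightarrow> (\<integral>\<omega>\<in>A. g \<omega> \<partial>M)"
proof -
  note [measurable] = f(1) g A
  have g2: "integrable M (\<lambda>\<omega>. g \<omega> ^ 2)" "(\<integral>\<omega>. g \<omega> ^ 2 \<partial>M) \<le> C"
  proof -
    have "AE \<omega> in M. (\<lambda>m. f m \<omega> ^ 2) \<longlonglongrightarrow> g \<omega> ^ 2"
      using lim by eventually_elim (intro tendsto_power)
    from Fatou_integrable[OF this _ f(2) _ C]
    show "integrable M (\<lambda>\<omega>. g \<omega> ^ 2)" "(\<integral>\<omega>. g \<omega> ^ 2 \<partial>M) \<le> C" by auto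
  qed
  have sq: "integrable M (\<lambda>\<omega>. 2 * (f m \<omega> ^ 2 + g \<omega> ^ 2))" for m using f(2) g2 by simp
  have le: "\<bar>f m \<omega> - g \<omega>\<bar> ^ 2 \<le> 2 * (f m \<omega> ^ 2 + g \<omega> ^ 2)" for m \<omega>
    using zero_le_power2[of "f m \<omega> + g \<omega>"] by (simp add: power2_eq_square algebra_simps)
  have i: "integrable M (\<lambda>\<omega>. \<bar>f m \<omega> - g \<omega>\<bar> ^ 2)" for m
    by (rule Bochner_Integration.integrable_bound[OF sq[of m]]) (use le in \<open>auto\<close>)
  have L1: "(\<lambda>m. \<integral>\<omega>. \<bar>f m \<omega> - g \<omega>\<bar> \<partial>M) \<longlonglongrightarrow> 0"
  proof (rule L1_convergence_of_bounded_square[OF _ i])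
    fix m
    have "(\<integral>\<omega>. \<bar>f m \<omega> - g \<omega>\<bar> ^ 2 \<partial>M) \<le> (\<integral>\<omega>. 2 * (f m \<omega> ^ 2 + g \<omega> ^ 2) \<partial>M)"
      by (intro integral_mono i sq le)
    also have "\<dots> \<le> 4 * C" using C[of m] g2 f(2) by simp
    finally show "(\<integral>\<omega>. \<bar>f m \<omega> - g \<omega>\<bar> ^ 2 \<partial>M) \<le> 4 * C" .
    show "AE \<omega> in M. (\<lambda>m. \<bar>f m \<omega> - g \<omega>\<bar>) \<longlonglongrightarrow> 0"
      using lim by eventually_elim (simp add: LIM_zero tendsto_rabs_zero)
  qed auto
  have bd: "norm ((\<integral>\<omega>\<in>A. f m \<omega> \<partial>M) - (\<integral>\<omega>\<in>A. g \<omega> \<partial>M)) \<le> (\<integral>\<omega>. \<bar>f m \<omega> - g \<omega>\<bar> \<partial>M)" for m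
  proof -
    have fi: "integrable M (f m)" "integrable M g" by (auto intro: square_integrable_imp_integrable[OF f(1)] square_integrable_imp_integrable[OF g] f(2) g2)
    then have s: "set_integrable M A (f m)" "set_integrable M A g"
      unfolding set_integrable_def
      using integrable_mult_indicator[OF A fi(1)] integrable_mult_indicator[OF A fi(2)] by auto
    have "(\<integral>\<omega>\<in>A. f m \<omega> \<partial>M) - (\<integral>\<omega>\<in>A. g \<omega> \<partial>M) = (\<integral>\<omega>\<in>A. (f m \<omega> - g \<omega>) \<partial>M)"
      using s by (simp add: set_integral_diff(2))
    also have "norm \<dots> \<le> (\<integral>\<omega>. norm (indicator A \<omega> *\<^sub>R (f m \<omega> - g \<omega>)) \<partial>M)"
      unfolding set_lebesgue_integral_def by (rule integral_norm_bound)
    also have "\<dots> \<le> (\<integral>\<omega>. \<bar>f m \<omega> - g \<omega>\<bar> \<partial>M)"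
      using fi A by (intro integral_mono integrable_norm integrable_mult_indicator) (auto simp: indicator_def)
    finally show ?thesis .
  qed
  have "(\<lambda>m. (\<integral>\<omega>\<in>A. f m \<omega> \<partial>M) - (\<integral>\<omega>\<in>A. g \<omega> \<partial>M)) \<longlonglongrightarrow> 0"
    by (rule Lim_null_comparison[OF always_eventually L1], rule allI, rule bd)
  then show ?thesis by (rule LIM_zero_cancel)
qed

lemma has_moments_const [simp]: "has_moments M (\<lambda>_. c)"
  by (simp add: has_moments_def)

lemma has_moments_bounded:
  assumes "f \<in> borel_measurable M" "AE \<omega> in M. \<bar>f \<omega>\<bar> \<le> c"
  shows "has_moments M f"
  by (rule has_moments_dominated[OF has_moments_const[of c] has_moments_const[of 0] assms(1)])
     (use assms(2) in eventually_elim, auto)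

end

section \<open>Martingales with finite moments\<close>

locale filtered_space = prob_space P for P :: "'w measure" +
  fixes F :: "real \<Rightarrow> 'w measure"
  assumes subalg: "0 \<le> t \<Longrightarrow> subalgebra P (F t)"
    and sets_mono: "0 \<le> s \<Longrightarrow> s \<le> t \<Longrightarrow> sets (F s) \<subseteq> sets (F t)"
begin

lemma space_F [simp]: "0 \<le> t \<Longrightarrow> space (F t) = space P"
  using subalg by (auto simp: subalgebra_def)

lemma sets_F: "0 \<le> t \<Longrightarrow> A \<in> sets (F t) \<Longrightarrow> A \<in> sets P"
  using subalg by (auto simp: subalgebra_def)

lemma measurable_P: "0 \<le> t \<Longrightarrow> f \<in> measurable (F t) N \<Longrightarrow> f \<in> measurable P N"
  using measurable_from_subalg[OF subalg] by blast

lemma measurable_F_mono: "0 \<le> s \<Longrightarrow> s \<le> t \<Longrightarrow> f \<in> measurable (F s) N \<Longrightarrow> f \<in> measurable (F t) N"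
  by (rule measurable_from_subalg[of "F t" "F s"]) (auto simp: subalgebra_def sets_mono)

lemma sigma_finite_F: "0 \<le> t \<Longrightarrow> sigma_finite_subalgebra P (F t)"
  by (intro finite_measure_subalgebra_is_sigma_finite finite_measure_subalgebra.intro
      finite_measure_subalgebra_axioms.intro subalg finite_measure_axioms)

definition moment_martingale :: "(real \<Rightarrow> 'w \<Rightarrow> real) \<Rightarrow> bool" where
  "moment_martingale M \<longleftrightarrow>
     (\<forall>t\<ge>0. M t \<in> borel_measurable (F t)) \<and> (\<forall>t\<ge>0. has_moments P (M t)) \<and>
     (\<forall>s t. 0 \<le> s \<longrightarrow> s \<le> t \<longrightarrow> (\<forall>A\<in>sets (F s). (\<integral>\<omega>\<in>A. M t \<omega> \<partial>P) = (\<integral>\<omega>\<in>A. M s \<omega> \<partial>P)))"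

lemma moment_martingaleD:
  assumes "moment_martingale M"
  shows "0 \<le> t \<Longrightarrow> M t \<in> borel_measurable (F t)"
    and "0 \<le> t \<Longrightarrow> has_moments P (M t)"
    and "0 \<le> s \<Longrightarrow> s \<le> t \<Longrightarrow> A \<in> sets (F s) \<Longrightarrow> (\<integral>\<omega>\<in>A. M t \<omega> \<partial>P) = (\<integral>\<omega>\<in>A. M s \<omega> \<partial>P)"
  using assms unfolding moment_martingale_def by blast+

lemma moment_martingaleI:
  assumes "\<And>t. 0 \<le> t \<Longrightarrow> M t \<in> borel_measurable (F t)"
    and "\<And>t. 0 \<le> t \<Longrightarrow> has_moments P (M t)"
    and "\<And>s t A. 0 \<le> s \<Longrightarrow> s \<le> t \<Longrightarrow> A \<in> sets (F s) \<Longrightarrow> (\<integral>\<omega>\<in>A. M t \<omega> \<partial>P) = (\<integral>\<omega>\<in>A. M s \<omega> \<partial>P)"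
  shows "moment_martingale M"
  unfolding moment_martingale_def by (intro conjI allI impI ballI assms)

lemma moment_martingale_cond_exp:
  assumes M: "moment_martingale M" and st: "0 \<le> s" "s \<le> t"
  shows "AE \<omega> in P. real_cond_exp P (F s) (M t) \<omega> = M s \<omega>"
proof -
  interpret sigma_finite_subalgebra P "F s" by (rule sigma_finite_F[OF st(1)])
  show ?thesis
    by (rule real_cond_exp_charact[OF moment_martingaleD(3)[OF M st]])
       (use moment_martingaleD[OF M] st in \<open>auto intro: has_momentsD(3)\<close>)
qed

text \<open>The increment \<open>M t - M s\<close> is orthogonal to every square integrable \<open>F s\<close>-measurable variable.\<close>

lemma moment_martingale_orthogonal:
  assumes M: "moment_martingale M" and st: "0 \<le> s" "s \<le> t"
    and Z: "Z \<in> borel_measurable (F s)" "integrable P (\<lambda>\<omega>. Z \<omega> ^ 2)"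
  shows "(\<integral>\<omega>. Z \<omega> * M t \<omega> \<partial>P) = (\<integral>\<omega>. Z \<omega> * M s \<omega> \<partial>P)"
    "integrable P (\<lambda>\<omega>. Z \<omega> * M t \<omega>)"
proof -
  interpret sigma_finite_subalgebra P "F s" by (rule sigma_finite_F[OF st(1)])
  have m: "has_moments P (M t)" "M s \<in> borel_measurable (F s)" using moment_martingaleD(1,2)[OF M] st by auto
  show i: "integrable P (\<lambda>\<omega>. Z \<omega> * M t \<omega>)"
    by (rule integrable_mult_square[OF measurable_P[OF st(1) Z(1)] has_momentsD(1)[OF m(1)] Z(2) has_momentsD(2)[OF m(1)]])
  have "(\<integral>\<omega>. Z \<omega> * M t \<omega> \<partial>P) = (\<integral>\<omega>. Z \<omega> * real_cond_exp P (F s) (M t) \<omega> \<partial>P)"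
    using i Z(1) has_momentsD(1)[OF m(1)] by (intro real_cond_exp_intg(2)[symmetric])
  also have "\<dots> = (\<integral>\<omega>. Z \<omega> * M s \<omega> \<partial>P)"
  proof (rule integral_cong_AE)
    note [measurable] = measurable_P[OF st(1) Z(1)] measurable_P[OF st(1) m(2)]
    show "(\<lambda>\<omega>. Z \<omega> * real_cond_exp P (F s) (M t) \<omega>) \<in> borel_measurable P" by measurable
    show "(\<lambda>\<omega>. Z \<omega> * M s \<omega>) \<in> borel_measurable P" by measurable
    show "AE \<omega> in P. Z \<omega> * real_cond_exp P (F s) (M t) \<omega> = Z \<omega> * M s \<omega>"
      using moment_martingale_cond_exp[OF M st] by eventually_elim simp
  qed
  finally show "(\<integral>\<omega>. Z \<omega> * M t \<omega> \<partial>P) = (\<integral>\<omega>. Z \<omega> * M s \<omega> \<partial>P)" .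
qed

lemma even_power_above_tangent: "(x::real) ^ (2 * k) + 2 * k * x ^ (2 * k - 1) * (y - x) \<le> y ^ (2 * k)"
proof -
  have "y ^ (2 * k) - x ^ (2 * k) \<ge> (2 * k * x ^ (2 * k - 1)) * (y - x)"
  proof (rule convex_on_imp_above_tangent[of UNIV])
    show "convex_on UNIV (\<lambda>x::real. x ^ (2 * k))" by (intro convex_power_even) auto
    show "((\<lambda>x. x ^ (2 * k)) has_field_derivative 2 * k * x ^ (2 * k - 1)) (at x within UNIV)"
      by (auto intro!: derivative_eq_intros)
  qed auto
  then show ?thesis by simp
qed

text \<open>The submartingale property of \<open>M ^ (2 * k)\<close>.  The tangent to \<open>x ^ (2 * k)\<close> at \<open>M s\<close> lies below this function, and its
linear term is an \<open>F s\<close>-measurable multiple of the increment, hence has expectation \<open>0\<close> over \<open>A\<close>.\<close>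

lemma moment_martingale_convex:
  assumes M: "moment_martingale M" and st: "0 \<le> s" "s \<le> t" and A: "A \<in> sets (F s)"
  shows "(\<integral>\<omega>\<in>A. M s \<omega> ^ (2 * k) \<partial>P) \<le> (\<integral>\<omega>\<in>A. M t \<omega> ^ (2 * k) \<partial>P)"
proof -
  have m: "has_moments P (M t)" "has_moments P (M s)" "M s \<in> borel_measurable (F s)"
    using moment_martingaleD(1,2)[OF M] st by auto
  have AP: "A \<in> sets P" using A st sets_F by auto
  define Z where "Z \<omega> = indicator A \<omega> * (2 * k * M s \<omega> ^ (2 * k - 1))" for \<omega>
  have Zm: "Z \<in> borel_measurable (F s)" unfolding Z_def using m(3) A by measurable
  have Z2: "integrable P (\<lambda>\<omega>. Z \<omega> ^ 2)"
  proof -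
    have "integrable P (\<lambda>\<omega>. indicator A \<omega> *\<^sub>R ((2 * k)^2 * M s \<omega> ^ ((2 * k - 1) * 2)))"
      using AP has_momentsD(2)[OF m(2)] by (intro integrable_mult_indicator integrable_mult_right)
    also have "(\<lambda>\<omega>. indicator A \<omega> *\<^sub>R ((2 * k)^2 * M s \<omega> ^ ((2 * k - 1) * 2))) = (\<lambda>\<omega>. Z \<omega> ^ 2)"
      by (auto simp: Z_def power_mult_distrib power_mult indicator_def)
    finally show ?thesis .
  qed
  note o = moment_martingale_orthogonal[OF M _ _ Zm Z2]
  have i: "integrable P (\<lambda>\<omega>. indicator A \<omega> *\<^sub>R M u \<omega> ^ (2 * k))" if "u = s \<or> u = t" for u
    using that AP has_momentsD(2)[OF m(1)] has_momentsD(2)[OF m(2)] by (intro integrable_mult_indicator) auto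
  have "(\<integral>\<omega>\<in>A. M s \<omega> ^ (2 * k) \<partial>P)
      = (\<integral>\<omega>. indicator A \<omega> *\<^sub>R M s \<omega> ^ (2 * k) + (Z \<omega> * M t \<omega> - Z \<omega> * M s \<omega>) \<partial>P)"
    unfolding set_lebesgue_integral_def using i[of s] o[of t] o[of s] st
    by (subst Bochner_Integration.integral_add) auto
  also have "\<dots> \<le> (\<integral>\<omega>. indicator A \<omega> *\<^sub>R M t \<omega> ^ (2 * k) \<partial>P)"
  proof (rule integral_mono)
    show "integrable P (\<lambda>\<omega>. indicator A \<omega> *\<^sub>R M s \<omega> ^ (2 * k) + (Z \<omega> * M t \<omega> - Z \<omega> * M s \<omega>))"
      using i[of s] o(2)[of t] o(2)[of s] st by auto
    show "integrable P (\<lambda>\<omega>. indicator A \<omega> *\<^sub>R M t \<omega> ^ (2 * k))" using i[of t] by auto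
    show "indicator A \<omega> *\<^sub>R M s \<omega> ^ (2 * k) + (Z \<omega> * M t \<omega> - Z \<omega> * M s \<omega>) \<le> indicator A \<omega> *\<^sub>R M t \<omega> ^ (2 * k)" for \<omega>
      using even_power_above_tangent[of "M s \<omega>" k "M t \<omega>"] by (auto simp: Z_def indicator_def algebra_simps)
  qed
  finally show ?thesis unfolding set_lebesgue_integral_def .
qed

lemma moment_martingale_AE_cong:
  assumes M: "moment_martingale M" and N: "\<And>t. 0 \<le> t \<Longrightarrow> N t \<in> borel_measurable (F t)"
    and eq: "\<And>t. 0 \<le> t \<Longrightarrow> AE \<omega> in P. N t \<omega> = M t \<omega>"
  shows "moment_martingale N"
proof -
  have Nm: "N t \<in> borel_measurable P" if "0 \<le> t" for t using N[OF that] measurable_P that by blast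
  have mom: "has_moments P (M t)" if "0 \<le> t" for t using moment_martingaleD(1,2)[OF M] that by auto
  have mom': "has_moments P (N t)" if "0 \<le> t" for t
    by (rule has_moments_dominated[OF mom[OF that] mom[OF that] Nm[OF that]])
       (use eq[OF that] in eventually_elim, auto)
  have int: "(\<integral>\<omega>\<in>A. N t \<omega> \<partial>P) = (\<integral>\<omega>\<in>A. M t \<omega> \<partial>P)" if "0 \<le> t" "A \<in> sets P" for t A
  proof (rule set_lebesgue_integral_cong_AE)
    show "AE \<omega>\<in>A in P. N t \<omega> = M t \<omega>" using eq[OF that(1)] by eventually_elim auto
  qed (use that Nm has_momentsD(1)[OF mom] in auto)
  show ?thesis
  proof (rule moment_martingaleI[OF N mom'])
    fix s t A assume st: "0 \<le> s" "s \<le> t" and A: "A \<in> sets (F s)"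
    show "(\<integral>\<omega>\<in>A. N t \<omega> \<partial>P) = (\<integral>\<omega>\<in>A. N s \<omega> \<partial>P)"
      using int[OF _ sets_F[OF st(1) A], of t] int[OF _ sets_F[OF st(1) A], of s]
        moment_martingaleD(3)[OF M st A] st by simp
  qed
qed

lemma moment_martingale_sum:
  assumes "finite I" and M: "\<And>i. i \<in> I \<Longrightarrow> moment_martingale (M i)"
  shows "moment_martingale (\<lambda>t \<omega>. \<Sum>i\<in>I. c i * M i t \<omega>)"
proof -
  have meas: "(\<lambda>\<omega>. \<Sum>i\<in>I. c i * M i t \<omega>) \<in> borel_measurable (F t)" if "0 \<le> t" for t
    using that by (intro borel_measurable_sum borel_measurable_times moment_martingaleD(1)[OF M]) auto
  have mom: "has_moments P (M i t)" if "0 \<le> t" "i \<in> I" for i t using moment_martingaleD(1,2)[OF M] that by auto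
  have moms: "has_moments P (\<lambda>\<omega>. c i * M i t \<omega>)" if "0 \<le> t" "i \<in> I" for i t
    using mom[OF that] by (auto simp: has_moments_def power_mult_distrib)
  have momJ: "has_moments P (\<lambda>\<omega>. \<Sum>i\<in>J. c i * M i t \<omega>)" if "0 \<le> t" "J \<subseteq> I" for J t
    using finite_subset[OF that(2) \<open>finite I\<close>] that(2)
  proof (induction J)
    case (insert j J)
    then have "has_moments P (\<lambda>\<omega>. c j * M j t \<omega>)" "has_moments P (\<lambda>\<omega>. \<Sum>i\<in>J. c i * M i t \<omega>)"
      using moms[OF that(1)] by auto
    from has_moments_dominated[OF this, of "\<lambda>\<omega>. \<Sum>i\<in>insert j J. c i * M i t \<omega>"]
      has_momentsD(1)[OF this(1)] has_momentsD(1)[OF this(2)]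
    show ?case using insert by simp
  qed simp
  have int: "(\<integral>\<omega>\<in>A. (\<Sum>i\<in>I. c i * M i t \<omega>) \<partial>P) = (\<Sum>i\<in>I. c i * (\<integral>\<omega>\<in>A. M i t \<omega> \<partial>P))"
    if "0 \<le> t" "A \<in> sets P" for t A
  proof -
    have "integrable P (\<lambda>\<omega>. indicator A \<omega> *\<^sub>R (c i * M i t \<omega>))" if "i \<in> I" for i
      by (rule integrable_mult_indicator[OF \<open>A \<in> sets P\<close> has_momentsD(3)[OF moms[OF \<open>0 \<le> t\<close> that]]])
    then show ?thesis unfolding set_lebesgue_integral_def
      by (simp only: scaleR_sum_right) (simp add: mult.left_commute)
  qed
  show ?thesis
  proof (rule moment_martingaleI[OF meas momJ])
    fix s t A assume st: "0 \<le> s" "s \<le> t" and A: "A \<in> sets (F s)"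
    have "(\<Sum>i\<in>I. c i * (\<integral>\<omega>\<in>A. M i t \<omega> \<partial>P)) = (\<Sum>i\<in>I. c i * (\<integral>\<omega>\<in>A. M i s \<omega> \<partial>P))"
      by (rule sum.cong[OF refl], subst moment_martingaleD(3)[OF M st A]) auto
    then show "(\<integral>\<omega>\<in>A. (\<Sum>i\<in>I. c i * M i t \<omega>) \<partial>P) = (\<integral>\<omega>\<in>A. (\<Sum>i\<in>I. c i * M i s \<omega>) \<partial>P)"
      using int[OF _ sets_F[OF st(1) A], of t] int[OF _ sets_F[OF st(1) A], of s] st by simp
  qed auto
qed

end

section \<open>Optional stopping\<close>

text \<open>For an increasing grid \<open>t\<close> and a time \<open>u\<close>, the value \<open>grid_ceil t j u\<close> is the first of the points
\<open>t 0, \<dots>, t j\<close> that lies strictly after \<open>u\<close>, or \<open>t j\<close> if there is none.  The recursion decides at time \<open>t j\<close> whether to proceed to the next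
point; this needs only the event \<open>t j \<le> u\<close>, which is known at time \<open>t j\<close> for a random time \<open>u\<close> with
\<open>{u < t j} \<in> F (t j)\<close>.\<close>

primrec grid_ceil :: "(nat \<Rightarrow> real) \<Rightarrow> nat \<Rightarrow> real \<Rightarrow> real" where
  "grid_ceil t 0 u = t 0"
| "grid_ceil t (Suc j) u = (if t j \<le> u then t (Suc j) else grid_ceil t j u)"

lemma grid_ceil_eq: "incseq t \<Longrightarrow> t j \<le> u \<Longrightarrow> grid_ceil t j u = t j"
  by (cases j) (auto dest: incseq_SucD intro: order_trans)

lemma grid_ceil_bounds:
  assumes "\<And>i. t i \<le> t (Suc i)" "\<And>i. t (Suc i) \<le> t i + h" "0 \<le> h"
  shows "max (t 0) (min u (t j)) \<le> grid_ceil t j u"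
    and "grid_ceil t j u \<le> max (t 0) (min u (t j)) + h"
proof (induction j)
  case (Suc j)
  have "t 0 \<le> t i" for i by (rule lift_Suc_mono_le[of t 0 i]) (use assms(1) in auto)
  from this[of j] this[of "Suc j"] assms(1,2)[of j] assms(3) Suc
  show "max (t 0) (min u (t (Suc j))) \<le> grid_ceil t (Suc j) u"
    "grid_ceil t (Suc j) u \<le> max (t 0) (min u (t (Suc j))) + h"
    by (auto simp: max_def min_def split: if_splits)
qed (use assms in auto)

lemma has_moments_even:
  assumes [measurable]: "f \<in> borel_measurable P" and "prob_space P" and i: "\<And>k. integrable P (\<lambda>\<omega>. f \<omega> ^ (2 * k))"
  shows "has_moments P f"
  unfolding has_moments_def
proof (intro conjI allI)
  interpret prob_space P by fact
  fix k
  show "integrable P (\<lambda>\<omega>. f \<omega> ^ k)"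
  proof (rule Bochner_Integration.integrable_bound)
    show "integrable P (\<lambda>\<omega>. 1 + f \<omega> ^ (2 * k))" using i by simp
    show "AE \<omega> in P. norm (f \<omega> ^ k) \<le> norm (1 + f \<omega> ^ (2 * k))"
    proof (rule AE_I2)
      fix \<omega>
      have "f \<omega> ^ (2 * k) = (f \<omega> ^ k) ^ 2" by (simp add: power_mult[symmetric] mult.commute)
      moreover have "2 * \<bar>f \<omega> ^ k\<bar> \<le> 1 + (f \<omega> ^ k) ^ 2"
        using sum_squares_bound[of 1 "\<bar>f \<omega> ^ k\<bar>"] by simp
      moreover have "\<bar>f \<omega> ^ k\<bar> \<le> 2 * \<bar>f \<omega> ^ k\<bar>" by simp
      ultimately show "norm (f \<omega> ^ k) \<le> norm (1 + f \<omega> ^ (2 * k))" by (simp only: real_norm_def)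
    qed
  qed measurable
qed fact

context filtered_space
begin

text \<open>The strict inequality is what distinguishes an optional time from a stopping time; it suffices here and is easier to verify for
infima of sets of times.\<close>

definition optional_time :: "('w \<Rightarrow> real) \<Rightarrow> bool" where
  "optional_time \<tau> \<longleftrightarrow> (\<forall>\<omega>. 0 \<le> \<tau> \<omega>) \<and> (\<forall>t\<ge>0. {\<omega> \<in> space P. \<tau> \<omega> < t} \<in> sets (F t))"

lemma optional_time_ge:
  assumes "optional_time \<tau>" "0 \<le> t"
  shows "{\<omega> \<in> space P. t \<le> \<tau> \<omega>} \<in> sets (F t)"
proof -
  have eq: "{\<omega> \<in> space P. t \<le> \<tau> \<omega>} = space (F t) - {\<omega> \<in> space P. \<tau> \<omega> < t}" using assms(2) by auto
  have "{\<omega> \<in> space P. \<tau> \<omega> < t} \<in> sets (F t)" using assms unfolding optional_time_def by blast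
  then show ?thesis unfolding eq by (rule sets.compl_sets)
qed

text \<open>Passing from \<open>j\<close> to \<open>j + 1\<close> changes the stopped variable by the increment \<open>M (t (j + 1)) - M (t j)\<close> on the event
\<open>t j \<le> \<tau>\<close> of \<open>F (t j)\<close>, and by nothing elsewhere, so its integral over sets of \<open>F (t 0)\<close> persists.
For even powers \<open>\<phi>\<close>, the gap \<open>\<phi> (M (t j)) - \<phi> (S j)\<close> grows by \<open>\<phi> (M (t (j + 1))) - \<phi> (M (t j))\<close> on the complementary
event, whose integral is nonnegative by convexity.\<close>

lemma discretely_stopped:
  assumes M: "moment_martingale M" and \<tau>: "optional_time \<tau>" and t: "incseq t" "0 \<le> t 0"
  defines "S \<equiv> \<lambda>j \<omega>. M (grid_ceil t j (\<tau> \<omega>)) \<omega>"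
  shows "S j \<in> borel_measurable (F (t j))" "has_moments P (S j)"
    and "A \<in> sets (F (t 0)) \<Longrightarrow> (\<integral>\<omega>\<in>A. S j \<omega> \<partial>P) = (\<integral>\<omega>\<in>A. M (t 0) \<omega> \<partial>P)"
    and "(\<integral>\<omega>. S j \<omega> ^ (2 * k) \<partial>P) \<le> (\<integral>\<omega>. M (t j) \<omega> ^ (2 * k) \<partial>P)"
proof -
  have t0: "0 \<le> t i" for i using t incseqD[OF t(1), of 0 i] by simp
  have tS: "t i \<le> t (Suc i)" for i using incseq_SucD[OF t(1)] .
  note Mm = moment_martingaleD(1)[OF M t0] and Mh = moment_martingaleD(2)[OF M t0]
  have *: "S j \<in> borel_measurable (F (t j)) \<and> has_moments P (S j) \<and>
    (\<forall>A\<in>sets (F (t 0)). (\<integral>\<omega>\<in>A. S j \<omega> \<partial>P) = (\<integral>\<omega>\<in>A. M (t 0) \<omega> \<partial>P)) \<and>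
    (\<integral>\<omega>. S j \<omega> ^ (2 * k) \<partial>P) \<le> (\<integral>\<omega>. M (t j) \<omega> ^ (2 * k) \<partial>P)"
  proof (induction j)
    case 0
    show ?case using Mm Mh by (simp add: S_def)
  next
    case (Suc j)
    define B where "B = {\<omega> \<in> space P. t j \<le> \<tau> \<omega>}"
    define C where "C = space P - B"
    have B: "B \<in> sets (F (t j))" unfolding B_def by (rule optional_time_ge[OF \<tau> t0])
    then have C: "C \<in> sets (F (t j))" using space_F[OF t0, of j] sets.compl_sets[of B "F (t j)"] by (simp add: C_def)
    have Sj: "S j \<in> borel_measurable (F (t j))" "has_moments P (S j)" using Suc by auto
    have SB: "S (Suc j) \<omega> = M (t (Suc j)) \<omega>" "S j \<omega> = M (t j) \<omega>" if "\<omega> \<in> B" for \<omega>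
      using that grid_ceil_eq[OF t(1)] by (auto simp: S_def B_def)
    have SC: "S (Suc j) \<omega> = S j \<omega>" if "\<omega> \<in> C" for \<omega>
      using that by (auto simp: S_def B_def C_def)
    have Smeas: "S (Suc j) \<in> borel_measurable (F (t (Suc j)))"
    proof -
      have "(\<lambda>\<omega>. if t j \<le> \<tau> \<omega> then M (t (Suc j)) \<omega> else S j \<omega>) \<in> borel_measurable (F (t (Suc j)))"
      proof (rule measurable_If)
        show "{\<omega> \<in> space (F (t (Suc j))). t j \<le> \<tau> \<omega>} \<in> sets (F (t (Suc j)))"
          using B sets_mono[OF t0 tS, of j] t0[of "Suc j"] by (auto simp: B_def)
      qed (use Mm measurable_F_mono[OF t0 tS Sj(1)] in auto)
      moreover have "S (Suc j) = (\<lambda>\<omega>. if t j \<le> \<tau> \<omega> then M (t (Suc j)) \<omega> else S j \<omega>)"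
        by (auto simp: S_def)
      ultimately show ?thesis by simp
    qed
    have Smom: "has_moments P (S (Suc j))"
      by (rule has_moments_dominated[OF Mh[of "Suc j"] Sj(2) measurable_P[OF t0 Smeas]])
         (auto simp: S_def)
    have "(\<integral>\<omega>\<in>A. S (Suc j) \<omega> \<partial>P) = (\<integral>\<omega>\<in>A. M (t 0) \<omega> \<partial>P)" if A: "A \<in> sets (F (t 0))" for A
    proof -
      have AB: "A \<inter> B \<in> sets (F (t j))" using A B sets_mono[of "t 0" "t j"] t0 incseqD[OF t(1), of 0 j] by auto
      have P: "A \<in> sets P" "A \<inter> B \<in> sets P" using sets_F[OF t0 A] sets_F[OF t0 AB] by auto
      note ind = integrable_mult_indicator[OF P(1)] integrable_mult_indicator[OF P(2)]
      have "(\<integral>\<omega>\<in>A. S (Suc j) \<omega> \<partial>P) = (\<integral>\<omega>. indicator A \<omega> *\<^sub>R S j \<omega> +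
          (indicator (A \<inter> B) \<omega> *\<^sub>R M (t (Suc j)) \<omega> - indicator (A \<inter> B) \<omega> *\<^sub>R M (t j) \<omega>) \<partial>P)"
        unfolding set_lebesgue_integral_def
      proof (rule Bochner_Integration.integral_cong)
        fix \<omega> assume "\<omega> \<in> space P"
        then show "indicat_real A \<omega> *\<^sub>R S (Suc j) \<omega> = indicator A \<omega> *\<^sub>R S j \<omega> +
          (indicator (A \<inter> B) \<omega> *\<^sub>R M (t (Suc j)) \<omega> - indicator (A \<inter> B) \<omega> *\<^sub>R M (t j) \<omega>)"
          using SB[of \<omega>] SC[of \<omega>] by (cases "\<omega> \<in> B") (auto simp: C_def indicator_def)
      qed simp
      also have "\<dots> = (\<integral>\<omega>\<in>A. S j \<omega> \<partial>P) + ((\<integral>\<omega>\<in>A \<inter> B. M (t (Suc j)) \<omega> \<partial>P) - (\<integral>\<omega>\<in>A \<inter> B. M (t j) \<omega> \<partial>P))"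
        unfolding set_lebesgue_integral_def
        using ind(1)[OF has_momentsD(3)[OF Sj(2)]] ind(2)[OF has_momentsD(3)[OF Mh]]
        by (subst Bochner_Integration.integral_add) (auto simp: Bochner_Integration.integral_diff)
      also have "\<dots> = (\<integral>\<omega>\<in>A. M (t 0) \<omega> \<partial>P)"
        using Suc A moment_martingaleD(3)[OF M t0 tS AB] by simp
      finally show ?thesis .
    qed
    moreover have "(\<integral>\<omega>. S (Suc j) \<omega> ^ (2 * k) \<partial>P) \<le> (\<integral>\<omega>. M (t (Suc j)) \<omega> ^ (2 * k) \<partial>P)"
    proof -
      have CP: "C \<in> sets P" using sets_F[OF t0 C] .
      note ind = integrable_mult_indicator[OF CP has_momentsD(2)[OF Mh]]
      have "(\<integral>\<omega>. S (Suc j) \<omega> ^ (2 * k) \<partial>P) = (\<integral>\<omega>. (M (t (Suc j)) \<omega> ^ (2 * k) - (M (t j) \<omega> ^ (2 * k) - S j \<omega> ^ (2 * k)))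
         - (indicator C \<omega> *\<^sub>R M (t (Suc j)) \<omega> ^ (2 * k) - indicator C \<omega> *\<^sub>R M (t j) \<omega> ^ (2 * k)) \<partial>P)"
      proof (rule Bochner_Integration.integral_cong)
        fix \<omega> assume "\<omega> \<in> space P"
        then show "S (Suc j) \<omega> ^ (2 * k) = (M (t (Suc j)) \<omega> ^ (2 * k) - (M (t j) \<omega> ^ (2 * k) - S j \<omega> ^ (2 * k)))
         - (indicator C \<omega> *\<^sub>R M (t (Suc j)) \<omega> ^ (2 * k) - indicator C \<omega> *\<^sub>R M (t j) \<omega> ^ (2 * k))"
          using SB[of \<omega>] SC[of \<omega>] by (cases "\<omega> \<in> B") (auto simp: C_def indicator_def)
      qed simp
      also have "\<dots> = ((\<integral>\<omega>. M (t (Suc j)) \<omega> ^ (2 * k) \<partial>P) - ((\<integral>\<omega>. M (t j) \<omega> ^ (2 * k) \<partial>P) - (\<integral>\<omega>. S j \<omega> ^ (2 * k) \<partial>P)))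
         - ((\<integral>\<omega>\<in>C. M (t (Suc j)) \<omega> ^ (2 * k) \<partial>P) - (\<integral>\<omega>\<in>C. M (t j) \<omega> ^ (2 * k) \<partial>P))"
        unfolding set_lebesgue_integral_def
        using ind[of "Suc j" "2 * k"] ind[of j "2 * k"] has_momentsD(2)[OF Mh] has_momentsD(2)[OF Sj(2)]
        by (simp add: Bochner_Integration.integral_diff)
      also have "\<dots> \<le> (\<integral>\<omega>. M (t (Suc j)) \<omega> ^ (2 * k) \<partial>P)"
        using moment_martingale_convex[OF M t0 tS C, of k] Suc by auto
      finally show ?thesis .
    qed
    ultimately show ?case using Smeas Smom by blast
  qed
  show "S j \<in> borel_measurable (F (t j))" "has_moments P (S j)"
    and "A \<in> sets (F (t 0)) \<Longrightarrow> (\<integral>\<omega>\<in>A. S j \<omega> \<partial>P) = (\<integral>\<omega>\<in>A. M (t 0) \<omega> \<partial>P)"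
    and "(\<integral>\<omega>. S j \<omega> ^ (2 * k) \<partial>P) \<le> (\<integral>\<omega>. M (t j) \<omega> ^ (2 * k) \<partial>P)"
    using * by blast+
qed

text \<open>Stopping between \<open>s\<close> and \<open>t\<close>: as the mesh \<open>(t - s) / (m + 1)\<close> of an equidistant grid of \<open>[s, t]\<close>
tends to \<open>0\<close>, the discretely stopped variables converge by path continuity, and they are bounded in \<open>L\<^sup>2\<close> by the
moments of \<open>M t\<close>.\<close>

lemma optional_stopping_interval:
  assumes M: "moment_martingale M" and \<tau>: "optional_time \<tau>" and st: "0 \<le> s" "s \<le> t"
    and cont: "\<And>\<omega>. \<omega> \<in> space P \<Longrightarrow> continuous_on {0..} (\<lambda>t. M t \<omega>)"
  defines "N \<equiv> \<lambda>\<omega>. M (max s (min (\<tau> \<omega>) t)) \<omega>"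
  shows "N \<in> borel_measurable (F t)" "has_moments P N"
    and "A \<in> sets (F s) \<Longrightarrow> (\<integral>\<omega>\<in>A. N \<omega> \<partial>P) = (\<integral>\<omega>\<in>A. M s \<omega> \<partial>P)"
    and "(\<integral>\<omega>. N \<omega> ^ (2 * k) \<partial>P) \<le> (\<integral>\<omega>. M t \<omega> ^ (2 * k) \<partial>P)"
proof -
  define g where "g m j = s + real j * ((t - s) / real (Suc m))" for m j
  have gS: "g m (Suc i) = g m i + (t - s) / real (Suc m)" for m i
    by (simp add: g_def distrib_right add_divide_distrib)
  have h0: "0 \<le> (t - s) / real (Suc m)" for m using st by simp
  have g: "g m i \<le> g m (Suc i)" "g m (Suc i) \<le> g m i + (t - s) / real (Suc m)" "incseq (g m)" "g m 0 = s" for m i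
    using h0 by (simp_all add: gS incseq_Suc_iff) (simp add: g_def)
  have gt: "g m (Suc m) = t" for m by (simp add: g_def)
  define S where "S m \<omega> = M (grid_ceil (g m) (Suc m) (\<tau> \<omega>)) \<omega>" for m \<omega>
  note discr = discretely_stopped[OF M \<tau> g(3), unfolded g(4), OF st(1)]
  have S: "S m \<in> borel_measurable (F t)" "has_moments P (S m)"
    "A \<in> sets (F s) \<Longrightarrow> (\<integral>\<omega>\<in>A. S m \<omega> \<partial>P) = (\<integral>\<omega>\<in>A. M s \<omega> \<partial>P)"
    "(\<integral>\<omega>. S m \<omega> ^ (2 * k) \<partial>P) \<le> (\<integral>\<omega>. M t \<omega> ^ (2 * k) \<partial>P)" for m k A
    using discr(1)[of m "Suc m"] discr(2)[of m "Suc m"] discr(3)[of A m "Suc m"] discr(4)[of m "Suc m" k]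
    unfolding S_def gt by (simp_all del: grid_ceil.simps)
  have lim: "(\<lambda>m. S m \<omega>) \<longlonglongrightarrow> N \<omega>" if "\<omega> \<in> space P" for \<omega>
  proof -
    let ?r = "max s (min (\<tau> \<omega>) t)"
    have b: "?r \<le> grid_ceil (g m) (Suc m) (\<tau> \<omega>)" "grid_ceil (g m) (Suc m) (\<tau> \<omega>) \<le> ?r + (t - s) / real (Suc m)" for m
      using grid_ceil_bounds[where t = "g m" and h = "(t - s) / real (Suc m)" and j = "Suc m" and u = "\<tau> \<omega>"] g(1,2)[of m] h0[of m]
      unfolding g(4) gt by blast+
    have "(\<lambda>m. ?r + (t - s) * inverse (real (Suc m))) \<longlonglongrightarrow> ?r + (t - s) * 0"
      by (intro tendsto_intros LIMSEQ_inverse_real_of_nat)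
    then have up: "(\<lambda>m. ?r + (t - s) / real (Suc m)) \<longlonglongrightarrow> ?r"
      by (simp only: divide_inverse mult_zero_right add_0_right)
    have "(\<lambda>m. grid_ceil (g m) (Suc m) (\<tau> \<omega>)) \<longlonglongrightarrow> ?r"
      by (rule tendsto_sandwich[OF always_eventually always_eventually tendsto_const up]; rule allI, rule b)
    moreover have "?r \<in> {0..}" using st by auto
    moreover have "\<forall>m. grid_ceil (g m) (Suc m) (\<tau> \<omega>) \<in> {0..}"
    proof
      fix m
      have "0 \<le> ?r" using st by auto
      from order_trans[OF this b(1)[of m]] show "grid_ceil (g m) (Suc m) (\<tau> \<omega>) \<in> {0..}" by (simp only: atLeast_iff)
    qed
    ultimately show ?thesis
      unfolding S_def N_def by (intro continuous_on_tendsto_compose[OF cont[OF that]] always_eventually)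
  qed
  have Mt: "has_moments P (M t)" using moment_martingaleD(2)[OF M] st by auto
  have t0: "0 \<le> t" using st by simp
  show meas: "N \<in> borel_measurable (F t)"
    by (rule borel_measurable_LIMSEQ_real[of _ S, OF lim S(1)]) (simp add: t0)
  have measP: "N \<in> borel_measurable P" by (rule measurable_P[OF t0 meas])
  have F: "integrable P (\<lambda>\<omega>. N \<omega> ^ (2 * k)) \<and> (\<integral>\<omega>. N \<omega> ^ (2 * k) \<partial>P) \<le> (\<integral>\<omega>. M t \<omega> ^ (2 * k) \<partial>P)" for k
  proof -
    have l: "AE \<omega> in P. (\<lambda>m. S m \<omega> ^ (2 * k)) \<longlonglongrightarrow> N \<omega> ^ (2 * k)"
      using lim by (intro AE_I2 tendsto_power)
    have nn: "0 \<le> S m \<omega> ^ (2 * k)" for m \<omega> by (simp add: power_mult)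
    from Fatou_integrable[OF l borel_measurable_power[OF measP] has_momentsD(2)[OF S(2)] nn S(4)]
    show ?thesis by simp
  qed
  then show "(\<integral>\<omega>. N \<omega> ^ (2 * k) \<partial>P) \<le> (\<integral>\<omega>. M t \<omega> ^ (2 * k) \<partial>P)" by simp
  show "has_moments P N" using F measP by (intro has_moments_even prob_space_axioms) auto
  show "(\<integral>\<omega>\<in>A. N \<omega> \<partial>P) = (\<integral>\<omega>\<in>A. M s \<omega> \<partial>P)" if A: "A \<in> sets (F s)"
  proof -
    have C: "(\<integral>\<omega>. S m \<omega> ^ 2 \<partial>P) \<le> (\<integral>\<omega>. M t \<omega> ^ 2 \<partial>P)" for m using S(4)[of m 1] by simp
    have "(\<lambda>m. \<integral>\<omega>\<in>A. S m \<omega> \<partial>P) \<longlonglongrightarrow> (\<integral>\<omega>\<in>A. N \<omega> \<partial>P)"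
      by (rule set_integral_limit_of_bounded_square[OF has_momentsD(1)[OF S(2)] has_momentsD(2)[OF S(2)] C _ measP sets_F[OF st(1) A]])
         (use lim in auto)
    then show ?thesis unfolding S(3)[OF A] by (simp add: LIMSEQ_const_iff)
  qed
qed

text \<open>For \<open>A \<in> F s\<close>, the two stopped values agree on \<open>\<tau> < s\<close>; on the event \<open>s \<le> \<tau>\<close> of \<open>F s\<close>
the value at \<open>t\<close> is the one stopped between \<open>s\<close> and \<open>t\<close>, and the value at \<open>s\<close> is \<open>M s\<close>.\<close>

lemma optional_stopping:
  assumes M: "moment_martingale M" and \<tau>: "optional_time \<tau>"
    and cont: "\<And>\<omega>. \<omega> \<in> space P \<Longrightarrow> continuous_on {0..} (\<lambda>t. M t \<omega>)"
  shows "moment_martingale (\<lambda>t \<omega>. M (min t (\<tau> \<omega>)) \<omega>)"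
    and "0 \<le> t \<Longrightarrow> (\<integral>\<omega>. M (min t (\<tau> \<omega>)) \<omega> ^ (2 * k) \<partial>P) \<le> (\<integral>\<omega>. M t \<omega> ^ (2 * k) \<partial>P)"
proof -
  have \<tau>0: "0 \<le> \<tau> \<omega>" for \<omega> using \<tau> by (auto simp: optional_time_def)
  have eq: "max 0 (min (\<tau> \<omega>) t) = min t (\<tau> \<omega>)" if "0 \<le> t" for t \<omega> using \<tau>0[of \<omega>] that by auto
  note N = optional_stopping_interval[OF M \<tau> order_refl _ cont, simplified eq]
  show "(\<integral>\<omega>. M (min t (\<tau> \<omega>)) \<omega> ^ (2 * k) \<partial>P) \<le> (\<integral>\<omega>. M t \<omega> ^ (2 * k) \<partial>P)" if "0 \<le> t"
    using N(4)[OF that] eq[OF that] by simp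
  have meas: "(\<lambda>\<omega>. M (min t (\<tau> \<omega>)) \<omega>) \<in> borel_measurable (F t)" if "0 \<le> t" for t
    using N(1)[OF that] eq[OF that] by simp
  have mom: "has_moments P (\<lambda>\<omega>. M (min t (\<tau> \<omega>)) \<omega>)" if "0 \<le> t" for t
    using N(2)[OF that] eq[OF that] by simp
  have "(\<integral>\<omega>\<in>A. M (min t (\<tau> \<omega>)) \<omega> \<partial>P) = (\<integral>\<omega>\<in>A. M (min s (\<tau> \<omega>)) \<omega> \<partial>P)"
    if st: "0 \<le> s" "s \<le> t" and A: "A \<in> sets (F s)" for s t A
  proof -
    define B where "B = {\<omega> \<in> space P. s \<le> \<tau> \<omega>}"
    have AB: "A \<inter> B \<in> sets (F s)" using A optional_time_ge[OF \<tau> st(1)] by (auto simp: B_def)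
    have P: "A \<in> sets P" "A \<inter> B \<in> sets P" using sets_F[OF st(1)] A AB by auto
    note ind = integrable_mult_indicator[OF P(1)] integrable_mult_indicator[OF P(2)]
    note I = optional_stopping_interval[OF M \<tau> st cont]
    let ?R = "\<lambda>\<omega>. M (max s (min (\<tau> \<omega>) t)) \<omega>"
    have "(\<integral>\<omega>\<in>A. M (min t (\<tau> \<omega>)) \<omega> \<partial>P) = (\<integral>\<omega>. indicator A \<omega> *\<^sub>R M (min s (\<tau> \<omega>)) \<omega> +
       (indicator (A \<inter> B) \<omega> *\<^sub>R ?R \<omega> - indicator (A \<inter> B) \<omega> *\<^sub>R M s \<omega>) \<partial>P)"
      unfolding set_lebesgue_integral_def
    proof (rule Bochner_Integration.integral_cong)
      fix \<omega> assume "\<omega> \<in> space P"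
      then show "indicat_real A \<omega> *\<^sub>R M (min t (\<tau> \<omega>)) \<omega> = indicator A \<omega> *\<^sub>R M (min s (\<tau> \<omega>)) \<omega> +
       (indicator (A \<inter> B) \<omega> *\<^sub>R ?R \<omega> - indicator (A \<inter> B) \<omega> *\<^sub>R M s \<omega>)"
        using st by (cases "s \<le> \<tau> \<omega>") (auto simp: B_def indicator_def max_def min_def)
    qed simp
    also have "\<dots> = (\<integral>\<omega>\<in>A. M (min s (\<tau> \<omega>)) \<omega> \<partial>P) + ((\<integral>\<omega>\<in>A \<inter> B. ?R \<omega> \<partial>P) - (\<integral>\<omega>\<in>A \<inter> B. M s \<omega> \<partial>P))"
      unfolding set_lebesgue_integral_def
      using ind(1)[OF has_momentsD(3)[OF mom[OF st(1)]]] ind(2)[OF has_momentsD(3)[OF I(2)]]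
        ind(2)[OF has_momentsD(3)[OF moment_martingaleD(2)[OF M st(1)]]]
      by (subst Bochner_Integration.integral_add) (auto simp: Bochner_Integration.integral_diff)
    also have "\<dots> = (\<integral>\<omega>\<in>A. M (min s (\<tau> \<omega>)) \<omega> \<partial>P)" using I(3)[OF _ AB] by simp
    finally show ?thesis .
  qed
  then show "moment_martingale (\<lambda>t \<omega>. M (min t (\<tau> \<omega>)) \<omega>)"
    by (intro moment_martingaleI meas mom)
qed

end

section \<open>Matrix-valued martingales\<close>

text \<open>Moments of the norm are controlled by moments of coordinates: the norm is at most the dimension times the
largest coordinate.\<close>

lemma norm_even_power_le_coordinates:
  fixes x :: "'a::euclidean_space"
  shows "norm x ^ (2 * k) \<le> DIM('a) ^ (2 * k) * (\<Sum>b\<in>Basis. (x \<bullet> b) ^ (2 * k))"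
proof -
  obtain b where b: "b \<in> (Basis :: 'a set)" "\<And>c. c \<in> Basis \<Longrightarrow> \<bar>x \<bullet> c\<bar> \<le> \<bar>x \<bullet> b\<bar>"
  proof -
    have "Max ((\<lambda>c. \<bar>x \<bullet> c\<bar>) ` Basis) \<in> (\<lambda>c. \<bar>x \<bullet> c\<bar>) ` Basis" by (rule Max_in) auto
    then obtain b where "b \<in> Basis" "Max ((\<lambda>c. \<bar>x \<bullet> c\<bar>) ` Basis) = \<bar>x \<bullet> b\<bar>" by blast
    moreover have "\<bar>x \<bullet> c\<bar> \<le> Max ((\<lambda>c. \<bar>x \<bullet> c\<bar>) ` Basis)" if "c \<in> Basis" for c
      using that by (intro Max_ge) auto
    ultimately show thesis using that by simp
  qed
  have "norm x \<le> (\<Sum>c\<in>Basis. \<bar>x \<bullet> c\<bar>)" by (rule norm_le_l1)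
  also have "\<dots> \<le> DIM('a) * \<bar>x \<bullet> b\<bar>" using b(2) by (rule sum_bounded_above)
  finally have "norm x ^ (2 * k) \<le> (DIM('a) * \<bar>x \<bullet> b\<bar>) ^ (2 * k)" by (intro power_mono) auto
  also have "\<dots> = DIM('a) ^ (2 * k) * (x \<bullet> b) ^ (2 * k)" by (simp add: power_mult_distrib power_even_abs)
  also have "(x \<bullet> b) ^ (2 * k) \<le> (\<Sum>b\<in>Basis. (x \<bullet> b) ^ (2 * k))"
    using b(1) by (intro member_le_sum) (auto simp: power_mult)
  finally show ?thesis by simp
qed

context prob_space
begin

lemma tr_abs_powr_square_integrable:
  fixes A :: "'a \<Rightarrow> complex^'n^'n"
  assumes [measurable]: "A \<in> borel_measurable M" and i: "integrable M (\<lambda>\<omega>. norm (A \<omega>) ^ (2 * k))"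
    and p: "0 < p" "p \<le> real k"
  shows "(\<lambda>\<omega>. tr_abs_powr p (A \<omega>)) \<in> borel_measurable M"
    "integrable M (\<lambda>\<omega>. tr_abs_powr p (A \<omega>) ^ 2)"
    "(\<integral>\<omega>. tr_abs_powr p (A \<omega>) ^ 2 \<partial>M) \<le> 1 + (\<integral>\<omega>. norm (A \<omega>) ^ (2 * k) \<partial>M)"
    "integrable M (\<lambda>\<omega>. tr_abs_powr p (A \<omega>))"
proof -
  show [measurable]: "(\<lambda>\<omega>. tr_abs_powr p (A \<omega>)) \<in> borel_measurable M"
    using measurable_compose[OF assms(1) tr_abs_powr_borel[OF p(1)]] .
  have le: "tr_abs_powr p B ^ 2 \<le> 1 + norm B ^ (2 * k)" for B :: "complex^'n^'n"
  proof -
    have "tr_abs_powr p B \<le> norm B powr p" using p by (intro tr_abs_powr_le) simp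
    then have "tr_abs_powr p B ^ 2 \<le> (norm B powr p) ^ 2" by (intro power_mono tr_abs_powr_nonneg)
    also have "\<dots> \<le> 1 + norm B ^ (2 * k)"
    proof (cases "norm B \<le> 1")
      case True
      then have "norm B powr p \<le> 1" using p by (intro powr_le1) auto
      then have "(norm B powr p) ^ 2 \<le> 1" by (simp add: power_le_one)
      moreover have "0 \<le> norm B ^ (2 * k)" by simp
      ultimately show ?thesis by linarith
    next
      case False
      then have "norm B powr p \<le> norm B powr real k" using p by (intro powr_mono) auto
      also have "\<dots> = norm B ^ k" using False by (intro powr_realpow) auto
      finally have "(norm B powr p) ^ 2 \<le> (norm B ^ k) ^ 2" by (intro power_mono) auto
      then show ?thesis by (simp add: power_mult[symmetric] mult.commute)
    qed
    finally show ?thesis .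
  qed
  have i1: "integrable M (\<lambda>\<omega>. 1 + norm (A \<omega>) ^ (2 * k))" using i by simp
  show i2: "integrable M (\<lambda>\<omega>. tr_abs_powr p (A \<omega>) ^ 2)"
    by (rule Bochner_Integration.integrable_bound[OF i1]) (use le in auto)
  have "(\<integral>\<omega>. tr_abs_powr p (A \<omega>) ^ 2 \<partial>M) \<le> (\<integral>\<omega>. 1 + norm (A \<omega>) ^ (2 * k) \<partial>M)"
    by (intro integral_mono i1 i2 le)
  then show "(\<integral>\<omega>. tr_abs_powr p (A \<omega>) ^ 2 \<partial>M) \<le> 1 + (\<integral>\<omega>. norm (A \<omega>) ^ (2 * k) \<partial>M)"
    using i by (simp add: prob_space)
  show "integrable M (\<lambda>\<omega>. tr_abs_powr p (A \<omega>))"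
    using i2 by (rule square_integrable_imp_integrable[rotated]) measurable
qed

lemma norm_diff_even_power_integral:
  fixes A B :: "'a \<Rightarrow> complex^'n^'n"
  assumes [measurable]: "A \<in> borel_measurable M" "B \<in> borel_measurable M"
    and i: "integrable M (\<lambda>\<omega>. norm (A \<omega>) ^ (2 * k))" "integrable M (\<lambda>\<omega>. norm (B \<omega>) ^ (2 * k))"
  shows "integrable M (\<lambda>\<omega>. norm (A \<omega> - B \<omega>) ^ (2 * k))"
    "(\<integral>\<omega>. norm (A \<omega> - B \<omega>) ^ (2 * k) \<partial>M)
      \<le> 2 ^ (2 * k) * ((\<integral>\<omega>. norm (A \<omega>) ^ (2 * k) \<partial>M) + (\<integral>\<omega>. norm (B \<omega>) ^ (2 * k) \<partial>M))"
proof -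
  have le: "norm (x - y) ^ (2 * k) \<le> 2 ^ (2 * k) * (norm x ^ (2 * k) + norm y ^ (2 * k))" for x y :: "complex^'n^'n"
  proof -
    have "norm (x - y) ^ (2 * k) \<le> (norm x + norm y) ^ (2 * k)" by (intro power_mono norm_triangle_ineq4) simp
    also have "\<dots> \<le> 2 ^ (2 * k) * (norm x ^ (2 * k) + norm y ^ (2 * k))" by (intro add_power_le) auto
    finally show ?thesis .
  qed
  have i1: "integrable M (\<lambda>\<omega>. 2 ^ (2 * k) * (norm (A \<omega>) ^ (2 * k) + norm (B \<omega>) ^ (2 * k)))" using i by simp
  show i2: "integrable M (\<lambda>\<omega>. norm (A \<omega> - B \<omega>) ^ (2 * k))"
    by (rule Bochner_Integration.integrable_bound[OF i1]) (use le in auto)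
  have "(\<integral>\<omega>. norm (A \<omega> - B \<omega>) ^ (2 * k) \<partial>M)
      \<le> (\<integral>\<omega>. 2 ^ (2 * k) * (norm (A \<omega>) ^ (2 * k) + norm (B \<omega>) ^ (2 * k)) \<partial>M)"
    by (intro integral_mono i1 i2 le)
  then show "(\<integral>\<omega>. norm (A \<omega> - B \<omega>) ^ (2 * k) \<partial>M)
      \<le> 2 ^ (2 * k) * ((\<integral>\<omega>. norm (A \<omega>) ^ (2 * k) \<partial>M) + (\<integral>\<omega>. norm (B \<omega>) ^ (2 * k) \<partial>M))"
    using i by simp
qed

end

lemma Lp_norm_eq: "Lp_norm P p A = (\<integral>\<omega>. tr_abs_powr p (A \<omega>) \<partial>P) powr (1 / p)"
  by (simp add: Lp_norm_def tr_abs_powr_def)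

lemma bounded_linear_matrix_vector: "bounded_linear ((*v) (A :: complex^'n^'n))"
proof (rule bounded_linear_intro[where K = "norm A"])
  show "A *v (x + y) = A *v x + A *v y" for x y by (rule matrix_vector_right_distrib)
  show "A *v (r *\<^sub>R x) = r *\<^sub>R (A *v x)" for r x
    by (simp add: vec_eq_iff matrix_vector_mult_def scaleR_right.sum)
  show "norm (A *v x) \<le> norm x * norm A" for x
    using norm_matrix_vector_mult_le[of A x] by (simp add: mult.commute)
qed

lemma mat_opnorm_nonneg: "0 \<le> mat_opnorm (A :: complex^'n^'n)"
  unfolding mat_opnorm_def by (rule onorm_pos_le[OF bounded_linear_matrix_vector])

text \<open>Measurability matters because the essential supremum of a function that is not measurable is infinite by definition.\<close>

lemma mat_opnorm_borel: "(mat_opnorm :: complex^'n^'n \<Rightarrow> real) \<in> borel_measurable borel"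
proof (rule borel_measurable_continuous_onI)
  have le: "mat_opnorm A \<le> mat_opnorm B + norm (A - B)" for A B :: "complex^'n^'n"
  proof -
    have "mat_opnorm A = onorm (\<lambda>v. B *v v + (A - B) *v v)"
      by (simp add: mat_opnorm_def matrix_vector_mult_diff_rdistrib)
    also have "\<dots> \<le> mat_opnorm B + mat_opnorm (A - B)"
      unfolding mat_opnorm_def by (intro onorm_triangle bounded_linear_matrix_vector)
    finally show ?thesis using mat_opnorm_le[of "A - B"] by linarith
  qed
  have "1-lipschitz_on UNIV (mat_opnorm :: complex^'n^'n \<Rightarrow> real)"
  proof (rule lipschitz_onI)
    fix A B :: "complex^'n^'n"
    show "dist (mat_opnorm A) (mat_opnorm B) \<le> 1 * dist A B"
      using le[of A B] le[of B A] by (simp add: dist_norm norm_minus_commute abs_le_iff)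
  qed simp
  then show "continuous_on UNIV (mat_opnorm :: complex^'n^'n \<Rightarrow> real)" by (rule lipschitz_on_continuous_on)
qed

context filtered_space
begin

text \<open>The pairings with all real linear functionals cover the real and imaginary parts of the entries, which determine the
conditional expectation, as well as the coordinates in any basis.\<close>

definition matrix_martingale :: "(real \<Rightarrow> 'w \<Rightarrow> complex^'n^'n) \<Rightarrow> bool" where
  "matrix_martingale V \<longleftrightarrow> (\<forall>v. moment_martingale (\<lambda>t \<omega>. V t \<omega> \<bullet> v))"

lemma matrix_martingaleD: "matrix_martingale V \<Longrightarrow> moment_martingale (\<lambda>t \<omega>. V t \<omega> \<bullet> v)"
  by (simp add: matrix_martingale_def)

lemma matrix_martingale_measurable:
  assumes V: "matrix_martingale V" and t: "0 \<le> t"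
  shows "V t \<in> borel_measurable (F t)" "V t \<in> borel_measurable P"
proof -
  show *: "V t \<in> borel_measurable (F t)"
    by (rule borel_measurable_euclidean_space[THEN iffD2], rule ballI)
       (rule moment_martingaleD(1)[OF matrix_martingaleD[OF V] t])
  show "V t \<in> borel_measurable P" by (rule measurable_P[OF t *])
qed

text \<open>A bound for \<open>E (norm (V t) ^ (2 * k))\<close> made of moments of coordinates.  Unlike the moment of the norm, it inherits
monotonicity in time and stability under stopping directly from the scalar results.\<close>

definition moment_bound :: "(real \<Rightarrow> 'w \<Rightarrow> complex^'n^'n) \<Rightarrow> nat \<Rightarrow> real \<Rightarrow> real" where
  "moment_bound V k t = DIM(complex^'n^'n) ^ (2 * k) * (\<Sum>b\<in>Basis. \<integral>\<omega>. (V t \<omega> \<bullet> b) ^ (2 * k) \<partial>P)"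

lemma matrix_martingale_moments:
  fixes V :: "real \<Rightarrow> 'w \<Rightarrow> complex^'n^'n"
  assumes V: "matrix_martingale V" and "0 \<le> t"
  shows "integrable P (\<lambda>\<omega>. norm (V t \<omega>) ^ (2 * k))"
    "(\<integral>\<omega>. norm (V t \<omega>) ^ (2 * k) \<partial>P) \<le> moment_bound V k t"
proof -
  note [measurable] = matrix_martingale_measurable(2)[OF assms]
  have m: "integrable P (\<lambda>\<omega>. (V t \<omega> \<bullet> b) ^ (2 * k))" for b
    using moment_martingaleD(2)[of "\<lambda>t \<omega>. V t \<omega> \<bullet> b"] assms has_momentsD(2) unfolding matrix_martingale_def by blast
  let ?g = "\<lambda>\<omega>. DIM(complex^'n^'n) ^ (2 * k) * (\<Sum>b\<in>Basis. (V t \<omega> \<bullet> b) ^ (2 * k))"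
  have g: "integrable P ?g" using m by simp
  show i: "integrable P (\<lambda>\<omega>. norm (V t \<omega>) ^ (2 * k))"
  proof (rule Bochner_Integration.integrable_bound[OF g])
    show "AE \<omega> in P. norm (norm (V t \<omega>) ^ (2 * k)) \<le> norm (?g \<omega>)"
      unfolding real_norm_def abs_of_nonneg[OF zero_le_power[OF norm_ge_zero]]
      by (intro AE_I2 order_trans[OF norm_even_power_le_coordinates abs_ge_self])
  qed measurable
  have "(\<integral>\<omega>. norm (V t \<omega>) ^ (2 * k) \<partial>P) \<le> (\<integral>\<omega>. ?g \<omega> \<partial>P)"
    by (intro integral_mono i g norm_even_power_le_coordinates)
  also have "\<dots> = moment_bound V k t" using m by (simp add: moment_bound_def)
  finally show "(\<integral>\<omega>. norm (V t \<omega>) ^ (2 * k) \<partial>P) \<le> moment_bound V k t" .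
qed

lemma moment_bound_mono:
  fixes V :: "real \<Rightarrow> 'w \<Rightarrow> complex^'n^'n"
  assumes V: "matrix_martingale V" and st: "0 \<le> s" "s \<le> t"
  shows "moment_bound V k s \<le> moment_bound V k t"
  unfolding moment_bound_def
proof (intro mult_left_mono sum_mono)
  fix b :: "complex^'n^'n"
  have "space P \<in> sets (F s)" using sets.top[of "F s"] st by simp
  have mV: "moment_martingale (\<lambda>t \<omega>. V t \<omega> \<bullet> b)" using V unfolding matrix_martingale_def by blast
  have i: "integrable P (\<lambda>\<omega>. (V u \<omega> \<bullet> b) ^ (2 * k))" if "0 \<le> u" for u
    by (rule has_momentsD(2)[OF moment_martingaleD(2)[OF mV that]])
  from moment_martingale_convex[OF mV st \<open>space P \<in> sets (F s)\<close>, of k]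
  have "(\<integral>\<omega>\<in>space P. (V s \<omega> \<bullet> b) ^ (2 * k) \<partial>P) \<le> (\<integral>\<omega>\<in>space P. (V t \<omega> \<bullet> b) ^ (2 * k) \<partial>P)"
    .
  then show "(\<integral>\<omega>. (V s \<omega> \<bullet> b) ^ (2 * k) \<partial>P) \<le> (\<integral>\<omega>. (V t \<omega> \<bullet> b) ^ (2 * k) \<partial>P)"
    using i st by (simp add: set_integral_space)
qed simp

lemma matrix_martingale_property:
  fixes V :: "real \<Rightarrow> 'w \<Rightarrow> complex^'n^'n"
  assumes V: "matrix_martingale V"
  shows "martingale_property P F V"
  unfolding martingale_property_def
proof (intro allI impI)
  fix s t :: real assume st: "0 \<le> s" "s \<le> t"
  have ce: "AE \<omega> in P. real_cond_exp P (F s) (\<lambda>\<omega>. V t \<omega> \<bullet> v) \<omega> = V s \<omega> \<bullet> v" for v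
    using moment_martingale_cond_exp[OF _ st, of "\<lambda>t \<omega>. V t \<omega> \<bullet> v"] V unfolding matrix_martingale_def by blast
  have RI: "Re (A $ i $ j) = A \<bullet> axis i (axis j 1)" "Im (A $ i $ j) = A \<bullet> axis i (axis j \<i>)"
    for A :: "complex^'n^'n" and i j
    by (simp_all add: inner_axis inner_complex_def)
  have "AE \<omega> in P. \<forall>i j. real_cond_exp P (F s) (\<lambda>\<omega>. Re (V t \<omega> $ i $ j)) \<omega> = Re (V s \<omega> $ i $ j) \<and>
     real_cond_exp P (F s) (\<lambda>\<omega>. Im (V t \<omega> $ i $ j)) \<omega> = Im (V s \<omega> $ i $ j)"
    unfolding RI using ce by (intro eventually_all_finite AE_conjI)
  then show "AE \<omega> in P. mat_cond_exp P (F s) (V t) \<omega> = V s \<omega>"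
    by eventually_elim (simp add: mat_cond_exp_def vec_eq_iff complex_eq_iff)
qed

lemma matrix_martingale_Lp_mat:
  assumes V: "matrix_martingale V" and "0 < p" "0 \<le> t"
  shows "V t \<in> Lp_mat P (F t) p"
proof -
  obtain k :: nat where k: "p \<le> real k" using real_arch_simple by blast
  show ?thesis
    using matrix_martingale_measurable[OF V] \<open>0 \<le> t\<close>
      tr_abs_powr_square_integrable(4)[OF _ matrix_martingale_moments(1)[OF V] \<open>0 < p\<close> k, of t]
    by (simp add: Lp_mat_def tr_abs_powr_def)
qed

text \<open>Along a sequence of times the differences tend to \<open>0\<close> almost surely, and their moments of order \<open>2 * k \<ge> 2 * p\<close> stay bounded,
so \<open>tr\<^sub>n (\<bar>D\<bar>\<^sup>p)\<close> tends to \<open>0\<close> in \<open>L\<^sup>1\<close>.\<close>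

lemma matrix_martingale_Lp_continuous:
  assumes V: "matrix_martingale V" and p: "0 < p" and t: "0 \<le> t"
    and cont: "AE \<omega> in P. continuous_on {0..} (\<lambda>t. V t \<omega>)"
  shows "((\<lambda>s. Lp_norm P p (\<lambda>\<omega>. V s \<omega> - V t \<omega>)) \<longlongrightarrow> 0) (at t within {0..})"
  unfolding tendsto_at_iff_sequentially comp_def
proof (intro allI impI)
  fix X :: "nat \<Rightarrow> real" assume X: "\<forall>i. X i \<in> {0..} - {t}" "X \<longlonglongrightarrow> t"
  obtain k :: nat where k: "p \<le> real k" using real_arch_simple by blast
  obtain T where T: "\<And>i. X i \<le> T"
    using convergent_imp_Bseq[of X] X(2) by (auto simp: convergent_def Bseq_def abs_le_iff)
  have X0: "0 \<le> X i" for i using X(1) by auto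
  define D where "D i \<omega> = V (X i) \<omega> - V t \<omega>" for i \<omega>
  define C where "C = 1 + 2 ^ (2 * k) * (moment_bound V k T + moment_bound V k t)"
  note mm = matrix_martingale_measurable(2)[OF V] and mi = matrix_martingale_moments(1)[OF V, of _ k]
  have Dm: "D i \<in> borel_measurable P" for i
    unfolding D_def using mm[OF X0] mm[OF t] by (intro borel_measurable_diff)
  note nd = norm_diff_even_power_integral[OF mm[OF X0] mm[OF t] mi[OF X0] mi[OF t], folded D_def]
  note h = tr_abs_powr_square_integrable[OF Dm nd(1) p k]
  have "(\<lambda>i. \<integral>\<omega>. tr_abs_powr p (D i \<omega>) \<partial>P) \<longlonglongrightarrow> 0"
  proof (rule L1_convergence_of_bounded_square[OF h(1,2) tr_abs_powr_nonneg])
    fix i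
    have "(\<integral>\<omega>. norm (V (X i) \<omega>) ^ (2 * k) \<partial>P) \<le> moment_bound V k T"
      using matrix_martingale_moments(2)[OF V X0] moment_bound_mono[OF V X0 T] by (rule order_trans)
    with matrix_martingale_moments(2)[OF V t, of k]
    have "2 ^ (2 * k) * ((\<integral>\<omega>. norm (V (X i) \<omega>) ^ (2 * k) \<partial>P) + (\<integral>\<omega>. norm (V t \<omega>) ^ (2 * k) \<partial>P))
       \<le> 2 ^ (2 * k) * (moment_bound V k T + moment_bound V k t)" by (intro mult_left_mono add_mono) auto
    with h(3)[of i] nd(2)[of i] show "(\<integral>\<omega>. tr_abs_powr p (D i \<omega>) ^ 2 \<partial>P) \<le> C"
      unfolding C_def by linarith
  next
    show "AE \<omega> in P. (\<lambda>i. tr_abs_powr p (D i \<omega>)) \<longlonglongrightarrow> 0"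
      using cont
    proof eventually_elim
      case (elim \<omega>)
      have "(\<lambda>i. V (X i) \<omega>) \<longlonglongrightarrow> V t \<omega>"
        using X0 t by (intro continuous_on_tendsto_compose[OF elim X(2)]) auto
      then have "(\<lambda>i. norm (D i \<omega>)) \<longlonglongrightarrow> 0" unfolding D_def by (intro tendsto_norm_zero LIM_zero)
      then have pw: "(\<lambda>i. norm (D i \<omega>) powr p) \<longlonglongrightarrow> 0" using p
        by (intro tendsto_zero_powrI[OF _ tendsto_const]) auto
      have le: "norm (tr_abs_powr p (D i \<omega>)) \<le> norm (D i \<omega>) powr p" for i
        using tr_abs_powr_nonneg[of p "D i \<omega>"] tr_abs_powr_le[of p "D i \<omega>"] p by simp
      show ?case by (rule Lim_null_comparison[OF always_eventually pw]) (rule allI, rule le)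
    qed
  qed
  then show "(\<lambda>i. Lp_norm P p (\<lambda>\<omega>. V (X i) \<omega> - V t \<omega>)) \<longlonglongrightarrow> 0"
    unfolding Lp_norm_eq D_def using p
    by (intro tendsto_zero_powrI[OF _ tendsto_const])
       (auto intro!: always_eventually integral_nonneg_AE tr_abs_powr_nonneg)
qed

lemma matrix_martingale_in_Lp_martingales:
  assumes "matrix_martingale V" "0 < p" "AE \<omega> in P. continuous_on {0..} (\<lambda>t. V t \<omega>)"
  shows "V \<in> Lp_martingales P F p"
  using assms matrix_martingale_Lp_mat matrix_martingale_Lp_continuous matrix_martingale_property
  unfolding Lp_martingales_def by blast

lemma Linf_norm_le:
  assumes "A \<in> borel_measurable P" "AE \<omega> in P. norm (A \<omega>) \<le> c"
  shows "Linf_norm P A \<le> ereal c"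
  unfolding Linf_norm_def
proof (rule esssup_I)
  show "(\<lambda>\<omega>. ereal (mat_opnorm (A \<omega>))) \<in> borel_measurable P"
    using measurable_compose[OF assms(1) mat_opnorm_borel] by measurable
  show "AE \<omega> in P. ereal (mat_opnorm (A \<omega>)) \<le> ereal c"
    using assms(2) by eventually_elim (use mat_opnorm_le order_trans in \<open>simp, blast\<close>)
qed

lemma Linf_norm_nonneg: "0 \<le> Linf_norm P (A :: 'w \<Rightarrow> complex^'n^'n)"
proof -
  have "AE \<omega> in P. 0 \<le> Linf_norm P A"
    using esssup_AE[of "\<lambda>\<omega>. ereal (mat_opnorm (A \<omega>))" P]
    by eventually_elim (metis Linf_norm_def ereal_less_eq(5) mat_opnorm_nonneg order_trans)
  then show ?thesis by (simp add: AE_const)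
qed

lemma matrix_martingale_in_Linf_martingales:
  assumes V: "matrix_martingale V"
    and bdd: "\<And>t. 0 \<le> t \<Longrightarrow> \<exists>c. AE \<omega> in P. norm (V t \<omega>) \<le> c"
    and cont: "\<And>e. 0 < e \<Longrightarrow> \<exists>d>0. \<forall>s\<ge>0. \<forall>t\<ge>0. \<bar>s - t\<bar> < d \<longrightarrow> (AE \<omega> in P. norm (V s \<omega> - V t \<omega>) \<le> e)"
  shows "V \<in> Linf_martingales P F"
  unfolding Linf_martingales_def
proof (intro CollectI conjI allI impI matrix_martingale_property[OF V])
  note mm = matrix_martingale_measurable[OF V]
  fix t :: real assume t: "0 \<le> t"
  obtain c where "AE \<omega> in P. norm (V t \<omega>) \<le> c" using bdd[OF t] by blast
  from Linf_norm_le[OF mm(2)[OF t] this] mm(1)[OF t]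
  show "V t \<in> Linf_mat P (F t)" unfolding Linf_mat_def
    by (auto intro: le_less_trans)
  show "((\<lambda>s. Linf_norm P (\<lambda>\<omega>. V s \<omega> - V t \<omega>)) \<longlongrightarrow> 0) (at t within {0..})"
  proof (rule order_tendstoI)
    fix a :: ereal assume "a < 0"
    then show "\<forall>\<^sub>F s in at t within {0..}. a < Linf_norm P (\<lambda>\<omega>. V s \<omega> - V t \<omega>)"
      using Linf_norm_nonneg less_le_trans by (intro always_eventually allI) blast
  next
    fix a :: ereal assume "0 < a"
    then obtain e where e: "0 < e" "ereal e < a" using ereal_dense2[of 0 a] by auto
    obtain d where d: "d > 0" "\<And>s. 0 \<le> s \<Longrightarrow> \<bar>s - t\<bar> < d \<Longrightarrow> AE \<omega> in P. norm (V s \<omega> - V t \<omega>) \<le> e"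
      using cont[OF e(1)] t by blast
    have "\<forall>\<^sub>F s in at t within {0..}. s \<in> {0..} \<and> dist s t < d"
      using d(1) unfolding eventually_at by blast
    then show "\<forall>\<^sub>F s in at t within {0..}. Linf_norm P (\<lambda>\<omega>. V s \<omega> - V t \<omega>) < a"
    proof eventually_elim
      case (elim s)
      then have s: "0 \<le> s" "\<bar>s - t\<bar> < d" by (auto simp: dist_real_def)
      from Linf_norm_le[OF borel_measurable_diff[OF mm(2)[OF s(1)] mm(2)[OF t]] d(2)[OF s]] e(2)
      show ?case by (rule le_less_trans)
    qed
  qed
qed

end

section \<open>Exit from a modulus of continuity\<close>

text \<open>The pairs of times are restricted to common denominators \<open>m + 1\<close>, which keeps the exit event a countable union and loses
nothing for continuous paths.\<close>

definition modulus_exit :: "(nat \<Rightarrow> real) \<Rightarrow> real \<Rightarrow> (real \<Rightarrow> 'a::metric_space) \<Rightarrow> real" where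
  "modulus_exit \<delta> T f = Inf (insert T {max (real i / real (Suc m)) (real j / real (Suc m)) | i j m k.
     \<bar>real i / real (Suc m) - real j / real (Suc m)\<bar> < \<delta> k \<and>
     1 / real (Suc k) < dist (f (real i / real (Suc m))) (f (real j / real (Suc m)))})"

lemma modulus_exit_less_iff:
  assumes "0 \<le> T"
  shows "modulus_exit \<delta> T f < t \<longleftrightarrow> T < t \<or> (\<exists>i j m k. real i / real (Suc m) < t \<and> real j / real (Suc m) < t \<and>
     \<bar>real i / real (Suc m) - real j / real (Suc m)\<bar> < \<delta> k \<and>
     1 / real (Suc k) < dist (f (real i / real (Suc m))) (f (real j / real (Suc m))))"
proof -
  let ?S = "{max (real i / real (Suc m)) (real j / real (Suc m)) | i j m k.
     \<bar>real i / real (Suc m) - real j / real (Suc m)\<bar> < \<delta> k \<and>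
     1 / real (Suc k) < dist (f (real i / real (Suc m))) (f (real j / real (Suc m)))}"
  have "bdd_below (insert T ?S)"
  proof (rule bdd_belowI)
    fix x assume "x \<in> insert T ?S"
    then show "0 \<le> x" using assms by (auto simp: le_max_iff_disj)
  qed
  then have "modulus_exit \<delta> T f < t \<longleftrightarrow> (\<exists>x\<in>insert T ?S. x < t)"
    unfolding modulus_exit_def by (intro cInf_less_iff) auto
  also have "\<dots> \<longleftrightarrow> T < t \<or> (\<exists>x\<in>?S. x < t)" by blast
  also have "(\<exists>x\<in>?S. x < t) \<longleftrightarrow> (\<exists>i j m k. max (real i / real (Suc m)) (real j / real (Suc m)) < t \<and>
     \<bar>real i / real (Suc m) - real j / real (Suc m)\<bar> < \<delta> k \<and>
     1 / real (Suc k) < dist (f (real i / real (Suc m))) (f (real j / real (Suc m))))"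
    by blast
  finally show ?thesis unfolding max_less_iff_conj conj_assoc .
qed

lemma modulus_exit_nonneg: "0 \<le> T \<Longrightarrow> 0 \<le> modulus_exit \<delta> T f"
  unfolding modulus_exit_def by (rule cInf_greatest) (auto simp: le_max_iff_disj)

text \<open>The strict bound by \<open>u\<close> also holds for \<open>r = u\<close>.  Thus the modulus, which by definition holds for grid times strictly before the exit,
extends to the exit time itself.\<close>

lemma grid_approximation_from_below:
  assumes "0 \<le> r" "r \<le> u" "0 < u"
  obtains i :: "nat \<Rightarrow> nat" where "\<And>m. real (i m) / real (Suc m) < u"
    "(\<lambda>m. real (i m) / real (Suc m)) \<longlonglongrightarrow> r"
proof
  \<comment> \<open>The largest integer strictly below \<open>r * (m + 1)\<close>; for \<open>r = 0\<close> this is \<open>-1\<close>, which \<open>nat\<close> sends to \<open>0 < u\<close>.\<close>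
  define i where "i m = nat (\<lceil>r * real (Suc m)\<rceil> - 1)" for m
  have b: "real (i m) / real (Suc m) \<le> r \<and> r - 1 / real (Suc m) \<le> real (i m) / real (Suc m)
     \<and> real (i m) / real (Suc m) < u" for m
  proof (cases "r = 0")
    case True
    then show ?thesis using assms by (simp add: i_def)
  next
    case False
    then have "0 < r * real (Suc m)" using assms by simp
    then have "1 \<le> \<lceil>r * real (Suc m)\<rceil>" by linarith
    then have i: "real (i m) = of_int \<lceil>r * real (Suc m)\<rceil> - 1" by (simp add: i_def)
    have 1: "real (i m) < r * real (Suc m)" "r * real (Suc m) - 1 \<le> real (i m)" unfolding i by linarith+
    from 1(1) have 2: "real (i m) / real (Suc m) < r" by (simp only: pos_divide_less_eq of_nat_0_less_iff zero_less_Suc)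
    from 1(2) have "(r * real (Suc m) - 1) / real (Suc m) \<le> real (i m) / real (Suc m)"
      by (intro divide_right_mono) auto
    then have "r - 1 / real (Suc m) \<le> real (i m) / real (Suc m)"
      by (simp only: diff_divide_distrib nonzero_mult_div_cancel_right of_nat_eq_0_iff nat.simps not_False_eq_True)
    with 2 assms show ?thesis by linarith
  qed
  then show "real (i m) / real (Suc m) < u" for m by blast
  have "(\<lambda>m. r - 1 / real (Suc m)) \<longlonglongrightarrow> r - 0"
    by (intro tendsto_diff tendsto_const LIMSEQ_Suc[OF lim_1_over_n])
  then have lo: "(\<lambda>m. r - 1 / real (Suc m)) \<longlonglongrightarrow> r" by simp
  show "(\<lambda>m. real (i m) / real (Suc m)) \<longlonglongrightarrow> r"
    by (rule tendsto_sandwich[OF always_eventually always_eventually lo tendsto_const]; use b in blast)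
qed

lemma modulus_exit_modulus:
  assumes f: "continuous_on {0..} f" and T: "0 \<le> T"
    and r: "0 \<le> r" "r \<le> modulus_exit \<delta> T f" and q: "0 \<le> q" "q \<le> modulus_exit \<delta> T f"
    and less: "\<bar>r - q\<bar> < \<delta> k"
  shows "dist (f r) (f q) \<le> 1 / real (Suc k)"
proof (cases "modulus_exit \<delta> T f = 0")
  case True
  then have "r = q" using r q by simp
  then show ?thesis by simp
next
  case False
  then have pos: "0 < modulus_exit \<delta> T f" using modulus_exit_nonneg[OF T, of \<delta> f] by linarith
  obtain i where i: "\<And>m. real (i m) / real (Suc m) < modulus_exit \<delta> T f" "(\<lambda>m. real (i m) / real (Suc m)) \<longlonglongrightarrow> r"
    using grid_approximation_from_below[OF r pos] by blast
  obtain j where j: "\<And>m. real (j m) / real (Suc m) < modulus_exit \<delta> T f" "(\<lambda>m. real (j m) / real (Suc m)) \<longlonglongrightarrow> q"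
    using grid_approximation_from_below[OF q pos] by blast
  have ev: "\<forall>\<^sub>F m in sequentially. \<bar>real (i m) / real (Suc m) - real (j m) / real (Suc m)\<bar> < \<delta> k"
    using tendsto_rabs[OF tendsto_diff[OF i(2) j(2)]] less by (rule order_tendstoD(2))
  have le: "\<forall>\<^sub>F m in sequentially. dist (f (real (i m) / real (Suc m))) (f (real (j m) / real (Suc m))) \<le> 1 / real (Suc k)"
    using ev
  proof eventually_elim
    case (elim m)
    have "\<not> modulus_exit \<delta> T f < modulus_exit \<delta> T f" by simp
    then show ?case
      unfolding modulus_exit_less_iff[OF T] using i(1)[of m] j(1)[of m] elim by (meson not_le)
  qed
  have lim: "(\<lambda>m. f (real (i m) / real (Suc m))) \<longlonglongrightarrow> f r" "(\<lambda>m. f (real (j m) / real (Suc m))) \<longlonglongrightarrow> f q"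
    by (rule continuous_on_tendsto_compose[OF f i(2)]; use r in simp)
       (rule continuous_on_tendsto_compose[OF f j(2)]; use q in simp)
  show ?thesis by (rule tendsto_upperbound[OF tendsto_dist[OF lim] le]) simp
qed

context filtered_space
begin

lemma exit_event_measurable:
  fixes x :: "real \<Rightarrow> 'w \<Rightarrow> 'a::{second_countable_topology, metric_space}"
  assumes x: "\<And>t. 0 \<le> t \<Longrightarrow> x t \<in> borel_measurable (F t)" and t: "0 \<le> t"
  shows "{\<omega> \<in> space P. real i / real (Suc m) < t \<and> real j / real (Suc m) < t \<and> Q \<and>
     c < dist (x (real i / real (Suc m)) \<omega>) (x (real j / real (Suc m)) \<omega>)} \<in> sets (F t)"
proof (cases "real i / real (Suc m) < t \<and> real j / real (Suc m) < t \<and> Q")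
  case True
  have m: "x (real l / real (Suc m)) \<in> borel_measurable (F t)" if "real l / real (Suc m) < t" for l
    by (rule measurable_F_mono[OF _ _ x]) (use that in auto)
  note [measurable] = m[OF conjunct1[OF True]] m[OF conjunct1[OF conjunct2[OF True]]]
  have "{\<omega> \<in> space (F t). c < dist (x (real i / real (Suc m)) \<omega>) (x (real j / real (Suc m)) \<omega>)} \<in> sets (F t)"
    by measurable
  moreover have "{\<omega> \<in> space P. real i / real (Suc m) < t \<and> real j / real (Suc m) < t \<and> Q \<and>
     c < dist (x (real i / real (Suc m)) \<omega>) (x (real j / real (Suc m)) \<omega>)}
     = {\<omega> \<in> space (F t). c < dist (x (real i / real (Suc m)) \<omega>) (x (real j / real (Suc m)) \<omega>)}"
    unfolding space_F[OF t] using True by blast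
  ultimately show ?thesis by (simp only:)
next
  case False
  then have "{\<omega> \<in> space P. real i / real (Suc m) < t \<and> real j / real (Suc m) < t \<and> Q \<and>
     c < dist (x (real i / real (Suc m)) \<omega>) (x (real j / real (Suc m)) \<omega>)} = {}" by blast
  then show ?thesis by (simp only: sets.empty_sets)
qed

lemma optional_time_modulus_exit:
  fixes x :: "real \<Rightarrow> 'w \<Rightarrow> 'a::{second_countable_topology, metric_space}"
  assumes x: "\<And>t. 0 \<le> t \<Longrightarrow> x t \<in> borel_measurable (F t)" and T: "0 \<le> T"
  shows "optional_time (\<lambda>\<omega>. modulus_exit \<delta> T (\<lambda>t. x t \<omega>))"
  unfolding optional_time_def
proof (intro conjI allI impI)
  show "0 \<le> modulus_exit \<delta> T (\<lambda>t. x t \<omega>)" for \<omega> by (rule modulus_exit_nonneg[OF T])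
  fix t :: real assume t: "0 \<le> t"
  have "{\<omega> \<in> space P. modulus_exit \<delta> T (\<lambda>t. x t \<omega>) < t} = {\<omega> \<in> space P. T < t} \<union>
    (\<Union>i. \<Union>j. \<Union>m. \<Union>k. {\<omega> \<in> space P. real i / real (Suc m) < t \<and> real j / real (Suc m) < t \<and>
     \<bar>real i / real (Suc m) - real j / real (Suc m)\<bar> < \<delta> k \<and>
     1 / real (Suc k) < dist (x (real i / real (Suc m)) \<omega>) (x (real j / real (Suc m)) \<omega>)})"
    unfolding modulus_exit_less_iff[OF T] by blast
  also have "\<dots> \<in> sets (F t)"
  proof (rule sets.Un)
    show "{\<omega> \<in> space P. T < t} \<in> sets (F t)" using sets.top[of "F t"] t by (cases "T < t") auto
  qed (intro sets.countable_UN'' countableI_type exit_event_measurable[OF x t]; simp)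
  finally show "{\<omega> \<in> space P. modulus_exit \<delta> T (\<lambda>t. x t \<omega>) < t} \<in> sets (F t)" .
qed

text \<open>For fixed \<open>k\<close>, the events that two times at distance less than \<open>1/(n+1)\<close> violate the bound \<open>1/(k+1)\<close> before \<open>T\<close> decrease
to the empty set as \<open>n\<close> grows, by uniform continuity on \<open>[0, T]\<close>.  Choosing \<open>n\<close> for each \<open>k\<close> such that the probability is below
\<open>\<epsilon> / 2 ^ (k+1)\<close> and summing over \<open>k\<close> gives the claim.\<close>

lemma modulus_exit_late:
  fixes x :: "real \<Rightarrow> 'w \<Rightarrow> 'a::{second_countable_topology, metric_space}"
  assumes x: "\<And>t. 0 \<le> t \<Longrightarrow> x t \<in> borel_measurable (F t)" and T: "0 \<le> T" and \<epsilon>: "0 < \<epsilon>"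
    and cont: "\<And>\<omega>. \<omega> \<in> space P \<Longrightarrow> continuous_on {0..} (\<lambda>t. x t \<omega>)"
  obtains \<delta> where "\<And>k. 0 < \<delta> k" "prob {\<omega> \<in> space P. modulus_exit \<delta> T (\<lambda>t. x t \<omega>) < T} \<le> \<epsilon>"
proof -
  define B where "B k n = (\<Union>i. \<Union>j. \<Union>m. {\<omega> \<in> space P. real i / real (Suc m) < T \<and> real j / real (Suc m) < T \<and>
     \<bar>real i / real (Suc m) - real j / real (Suc m)\<bar> < 1 / real (Suc n) \<and>
     1 / real (Suc k) < dist (x (real i / real (Suc m)) \<omega>) (x (real j / real (Suc m)) \<omega>)})" for k n
  have BF: "B k n \<in> sets (F T)" for k n
    unfolding B_def by (intro sets.countable_UN'' countableI_type exit_event_measurable[OF x T]; simp)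
  then have BP: "B k n \<in> sets P" for k n using sets_F[OF T] by blast
  have "\<exists>n. prob (B k n) < \<epsilon> * (1 / 2) ^ Suc k" for k
  proof -
    have "decseq (B k)"
    proof (rule decseq_SucI)
      fix n
      have "1 / real (Suc (Suc n)) < 1 / real (Suc n)" by (simp add: field_simps)
      then show "B k (Suc n) \<subseteq> B k n" unfolding B_def by (blast intro: less_trans)
    qed
    moreover have "(\<Inter>n. B k n) = {}"
    proof (rule equals0I)
      fix \<omega> assume *: "\<omega> \<in> (\<Inter>n. B k n)"
      then have "\<omega> \<in> B k 0" by blast
      then have \<omega>: "\<omega> \<in> space P" unfolding B_def by blast
      have "uniformly_continuous_on {0..T} (\<lambda>t. x t \<omega>)"
        by (rule compact_uniformly_continuous[OF continuous_on_subset[OF cont[OF \<omega>]]]) auto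
      then obtain d where d: "0 < d" "\<And>s t. s \<in> {0..T} \<Longrightarrow> t \<in> {0..T} \<Longrightarrow> dist s t < d \<Longrightarrow>
          dist (x s \<omega>) (x t \<omega>) < 1 / real (Suc k)"
        unfolding uniformly_continuous_on_def by (metis of_nat_0_less_iff zero_less_Suc zero_less_divide_1_iff)
      obtain n where n: "1 / real (Suc n) < d" using nat_approx_posE[OF d(1)] by (auto simp: inverse_eq_divide)
      from * have "\<omega> \<in> B k n" by blast
      then obtain i j m where "real i / real (Suc m) < T" "real j / real (Suc m) < T"
        "\<bar>real i / real (Suc m) - real j / real (Suc m)\<bar> < 1 / real (Suc n)"
        "1 / real (Suc k) < dist (x (real i / real (Suc m)) \<omega>) (x (real j / real (Suc m)) \<omega>)"
        unfolding B_def by blast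
      with d(2)[of "real i / real (Suc m)" "real j / real (Suc m)"] n show False
        by (simp add: dist_real_def)
    qed
    ultimately have "(\<lambda>n. prob (B k n)) \<longlonglongrightarrow> 0"
      using finite_Lim_measure_decseq[of "B k"] BP by auto
    then have "\<forall>\<^sub>F n in sequentially. prob (B k n) < \<epsilon> * (1 / 2) ^ Suc k"
      using \<epsilon> by (intro order_tendstoD(2)[where y = 0]) auto
    then show ?thesis by (meson eventually_happens' sequentially_bot)
  qed
  then obtain n where n: "\<And>k. prob (B k (n k)) < \<epsilon> * (1 / 2) ^ Suc k" by metis
  define \<delta> where "\<delta> k = 1 / real (Suc (n k))" for k
  have half: "(\<lambda>k. \<epsilon> * (1 / 2) ^ Suc k) sums (\<epsilon> * 1)" by (intro sums_mult power_half_series)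
  have sm: "summable (\<lambda>k. prob (B k (n k)))"
    by (rule summable_comparison_test'[OF sums_summable[OF half]]) (use n in \<open>auto intro: less_imp_le\<close>)
  have "{\<omega> \<in> space P. modulus_exit \<delta> T (\<lambda>t. x t \<omega>) < T} \<subseteq> (\<Union>k. B k (n k))"
    unfolding modulus_exit_less_iff[OF T] B_def \<delta>_def by blast
  then have "prob {\<omega> \<in> space P. modulus_exit \<delta> T (\<lambda>t. x t \<omega>) < T} \<le> prob (\<Union>k. B k (n k))"
    using BP by (intro finite_measure_mono) auto
  also have "\<dots> \<le> (\<Sum>k. prob (B k (n k)))"
    using BP sm by (intro finite_measure_subadditive_countably) auto
  also have "\<dots> \<le> (\<Sum>k. \<epsilon> * (1 / 2) ^ Suc k)"
    using n sm sums_summable[OF half] by (intro suminf_le) (auto intro: less_imp_le)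
  also have "\<dots> = \<epsilon>" using sums_unique[OF half] by simp
  finally show thesis by (intro that[of \<delta>]) (simp_all add: \<delta>_def)
qed

end

context filtered_space
begin

section \<open>Approximation by a stopped martingale\<close>

lemma matrix_martingale_stopped:
  assumes V: "matrix_martingale V" and \<tau>: "optional_time \<tau>"
    and cont: "\<And>\<omega>. \<omega> \<in> space P \<Longrightarrow> continuous_on {0..} (\<lambda>t. V t \<omega>)"
  shows "matrix_martingale (\<lambda>t \<omega>. V (min t (\<tau> \<omega>)) \<omega>)"
    and "0 \<le> t \<Longrightarrow> moment_bound (\<lambda>t \<omega>. V (min t (\<tau> \<omega>)) \<omega>) k t \<le> moment_bound V k t"
proof -
  have c: "continuous_on {0..} (\<lambda>t. V t \<omega> \<bullet> v)" if "\<omega> \<in> space P" for \<omega> v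
    by (intro continuous_on_inner cont[OF that] continuous_on_const)
  note os = optional_stopping[OF matrix_martingaleD[OF V] \<tau> c]
  show "matrix_martingale (\<lambda>t \<omega>. V (min t (\<tau> \<omega>)) \<omega>)"
    unfolding matrix_martingale_def by (rule allI) (rule os(1))
  show "moment_bound (\<lambda>t \<omega>. V (min t (\<tau> \<omega>)) \<omega>) k t \<le> moment_bound V k t" if "0 \<le> t"
    unfolding moment_bound_def by (intro mult_left_mono sum_mono os(2)[OF _ that]) auto
qed

text \<open>In steps of length \<open>d / 2\<close> the norm grows by at most \<open>1\<close> per step.\<close>

lemma bounded_if_unit_modulus:
  fixes f :: "real \<Rightarrow> 'a::real_normed_vector"
  assumes f0: "f 0 = 0" and d: "0 < d" and mod: "\<And>s t. 0 \<le> s \<Longrightarrow> 0 \<le> t \<Longrightarrow> \<bar>s - t\<bar> < d \<Longrightarrow> dist (f s) (f t) \<le> 1"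
    and t: "0 \<le> t" "t \<le> real j * (d / 2)"
  shows "norm (f t) \<le> real j"
  using t
proof (induction j arbitrary: t)
  case (Suc j)
  define s where "s = max 0 (t - d / 2)"
  have "t - d / 2 \<le> real j * (d / 2)" using Suc.prems by (simp add: algebra_simps)
  moreover have "0 \<le> real j * (d / 2)" using d by simp
  ultimately have s: "0 \<le> s" "s \<le> real j * (d / 2)" "\<bar>s - t\<bar> < d"
    unfolding s_def using Suc.prems(1) d by (simp_all add: max_def)
  have "norm (f t) \<le> norm (f s) + dist (f s) (f t)"
    using norm_triangle_sub[of "f t" "f s"] by (simp add: dist_norm norm_minus_commute)
  also have "\<dots> \<le> real j + 1" using Suc.IH[OF s(1,2)] mod[OF s(1) Suc.prems(1) s(3)] by linarith
  finally show ?case by simp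
qed (simp add: f0)

lemma matrix_martingale_approximation:
  fixes V :: "real \<Rightarrow> 'w \<Rightarrow> complex^'n^'n"
  assumes V: "matrix_martingale V"
    and cont: "\<And>\<omega>. \<omega> \<in> space P \<Longrightarrow> continuous_on {0..} (\<lambda>t. V t \<omega>)"
    and V0: "\<And>\<omega>. \<omega> \<in> space P \<Longrightarrow> V 0 \<omega> = 0"
    and p: "0 < p" and T: "0 \<le> T" and e: "0 < e"
  obtains N where "N \<in> Linf_martingales P F" "N \<in> Lp_martingales P F p"
    "\<And>t. 0 \<le> t \<Longrightarrow> t \<le> T \<Longrightarrow> (\<integral>\<omega>. tr_abs_powr p (N t \<omega> - V t \<omega>) \<partial>P) < e"
proof -
  obtain k :: nat where k: "p \<le> real k" using real_arch_simple by blast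
  define C where "C = 1 + 2 ^ (2 * k) * (moment_bound V k T + moment_bound V k T)"
  have nn: "0 \<le> moment_bound V k t" for t
    unfolding moment_bound_def
    by (intro mult_nonneg_nonneg sum_nonneg Bochner_Integration.integral_nonneg) (auto simp: power_mult)
  have C: "0 < C" unfolding C_def using nn[of T] by (intro add_pos_nonneg mult_nonneg_nonneg) auto
  \<comment> \<open>With this truncation level the tail contributes \<open>C / K = e / 2\<close>, and the event \<open>\<tau> < T\<close> contributes at most \<open>e / 4\<close>.\<close>
  define K where "K = 2 * C / e"
  have K: "0 < K" using C e by (simp add: K_def)
  have \<epsilon>: "0 < e / (4 * K)" using e K by simp
  note Vm = matrix_martingale_measurable[OF V]
  obtain \<delta> where \<delta>: "\<And>k. 0 < \<delta> k" and
    late: "prob {\<omega> \<in> space P. modulus_exit \<delta> T (\<lambda>t. V t \<omega>) < T} \<le> e / (4 * K)"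
    using modulus_exit_late[OF Vm(1) T \<epsilon> cont] by blast
  define \<tau> where "\<tau> \<omega> = modulus_exit \<delta> T (\<lambda>t. V t \<omega>)" for \<omega>
  have \<tau>: "optional_time \<tau>" unfolding \<tau>_def by (rule optional_time_modulus_exit[OF Vm(1) T])
  have \<tau>0: "0 \<le> \<tau> \<omega>" for \<omega> unfolding \<tau>_def by (rule modulus_exit_nonneg[OF T])
  define N where "N t \<omega> = V (min t (\<tau> \<omega>)) \<omega>" for t \<omega>
  have N: "matrix_martingale N" and mbN: "\<And>t. 0 \<le> t \<Longrightarrow> moment_bound N k t \<le> moment_bound V k t"
    unfolding N_def using matrix_martingale_stopped[OF V \<tau> cont] by blast+
  have mod: "dist (N s \<omega>) (N t \<omega>) \<le> 1 / real (Suc l)"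
    if "\<omega> \<in> space P" "0 \<le> s" "0 \<le> t" "\<bar>s - t\<bar> < \<delta> l" for s t \<omega> l
  proof -
    have "\<bar>min s (\<tau> \<omega>) - min t (\<tau> \<omega>)\<bar> < \<delta> l" using that(4) by linarith
    then show ?thesis
      unfolding N_def using that(2,3) \<tau>0[of \<omega>]
      by (intro modulus_exit_modulus[OF cont[OF that(1)] T]) (auto simp: \<tau>_def)
  qed
  have contN: "continuous_on {0..} (\<lambda>t. N t \<omega>)" if "\<omega> \<in> space P" for \<omega>
    unfolding N_def
    by (rule continuous_on_compose2[OF cont[OF that]]) (use \<tau>0 in \<open>auto intro!: continuous_intros\<close>)
  have "N \<in> Linf_martingales P F"
  proof (rule matrix_martingale_in_Linf_martingales[OF N])
    fix t :: real assume t: "0 \<le> t"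
    obtain j :: nat where "t / (\<delta> 0 / 2) \<le> real j" using real_arch_simple by blast
    then have j: "t \<le> real j * (\<delta> 0 / 2)" using \<delta>[of 0] by (simp add: divide_le_eq)
    have "norm (N t \<omega>) \<le> real j" if "\<omega> \<in> space P" for \<omega>
    proof (rule bounded_if_unit_modulus[OF _ \<delta>[of 0] _ t j])
      show "N 0 \<omega> = 0" using V0[OF that] \<tau>0[of \<omega>] by (simp add: N_def)
      show "dist (N s \<omega>) (N t \<omega>) \<le> 1" if "0 \<le> s" "0 \<le> t" "\<bar>s - t\<bar> < \<delta> 0" for s t
        using mod[OF \<open>\<omega> \<in> space P\<close> that] by simp
    qed
    then show "\<exists>c. AE \<omega> in P. norm (N t \<omega>) \<le> c" by (blast intro: AE_I2)
  next
    fix e :: real assume "0 < e"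
    then obtain l where l: "1 / real (Suc l) < e" using nat_approx_posE by (metis inverse_eq_divide)
    have "AE \<omega> in P. norm (N s \<omega> - N t \<omega>) \<le> e" if "0 \<le> s" "0 \<le> t" "\<bar>s - t\<bar> < \<delta> l" for s t
    proof (rule AE_I2)
      fix \<omega> assume "\<omega> \<in> space P"
      from mod[OF this that] l show "norm (N s \<omega> - N t \<omega>) \<le> e" unfolding dist_norm by linarith
    qed
    then show "\<exists>d>0. \<forall>s\<ge>0. \<forall>t\<ge>0. \<bar>s - t\<bar> < d \<longrightarrow> (AE \<omega> in P. norm (N s \<omega> - N t \<omega>) \<le> e)"
      using \<delta>[of l] by blast
  qed
  moreover have "N \<in> Lp_martingales P F p"
    by (rule matrix_martingale_in_Lp_martingales[OF N p AE_I2[OF contN]])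
  moreover have "(\<integral>\<omega>. tr_abs_powr p (N t \<omega> - V t \<omega>) \<partial>P) < e" if t: "0 \<le> t" "t \<le> T" for t
  proof -
    note Nm = matrix_martingale_measurable[OF N]
    note mN = matrix_martingale_moments[OF N t(1), of k] and mV = matrix_martingale_moments[OF V t(1), of k]
    note D = norm_diff_even_power_integral[OF Nm(2)[OF t(1)] Vm(2)[OF t(1)] mN(1) mV(1)]
    note h = tr_abs_powr_square_integrable[OF borel_measurable_diff[OF Nm(2)[OF t(1)] Vm(2)[OF t(1)]] D(1) p k]
    have "(\<integral>\<omega>. norm (N t \<omega>) ^ (2 * k) \<partial>P) + (\<integral>\<omega>. norm (V t \<omega>) ^ (2 * k) \<partial>P)
        \<le> moment_bound V k T + moment_bound V k T"
      using mN(2) mV(2) mbN[OF t(1)] moment_bound_mono[OF V t, of k] by linarith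
    then have "2 ^ (2 * k) * ((\<integral>\<omega>. norm (N t \<omega>) ^ (2 * k) \<partial>P) + (\<integral>\<omega>. norm (V t \<omega>) ^ (2 * k) \<partial>P))
        \<le> 2 ^ (2 * k) * (moment_bound V k T + moment_bound V k T)" by (rule mult_left_mono) simp
    with h(3) D(2) have sq: "(\<integral>\<omega>. tr_abs_powr p (N t \<omega> - V t \<omega>) ^ 2 \<partial>P) \<le> C"
      unfolding C_def by linarith
    define A where "A = {\<omega> \<in> space P. \<tau> \<omega> < T}"
    have "A \<in> sets (F T)" unfolding A_def using \<tau> T unfolding optional_time_def by blast
    then have A: "A \<in> sets P" by (rule sets_F[OF T])
    have "(\<integral>\<omega>. min (tr_abs_powr p (N t \<omega> - V t \<omega>)) K \<partial>P) \<le> (\<integral>\<omega>. K * indicator A \<omega> \<partial>P)"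
    proof (rule integral_mono_AE)
      have "min (tr_abs_powr p (N t \<omega> - V t \<omega>)) K \<le> K * indicator A \<omega>" if "\<omega> \<in> space P" for \<omega>
      proof (cases "\<omega> \<in> A")
        case False
        then have "N t \<omega> = V t \<omega>" using that t by (simp add: N_def A_def min_def)
        then have "tr_abs_powr p (N t \<omega> - V t \<omega>) \<le> 0" using tr_abs_powr_le[of p "0 :: complex^'n^'n"] p by simp
        with False show ?thesis by simp
      qed simp
      then show "AE \<omega> in P. min (tr_abs_powr p (N t \<omega> - V t \<omega>)) K \<le> K * indicator A \<omega>" by (rule AE_I2)
      show "integrable P (\<lambda>\<omega>. min (tr_abs_powr p (N t \<omega> - V t \<omega>)) K)"
        by (intro Bochner_Integration.integrable_min h(4)) simp
      show "integrable P (\<lambda>\<omega>. K * indicator A \<omega>)"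
        by (intro integrable_mult_right integrable_real_indicator A) (simp add: emeasure_eq_measure)
    qed
    also have "\<dots> = K * prob A" using A by simp
    also have "\<dots> \<le> K * (e / (4 * K))"
      using late K by (intro mult_left_mono) (auto simp: A_def \<tau>_def)
    also have "\<dots> = e / 4" using K by simp
    finally have "(\<integral>\<omega>. min (tr_abs_powr p (N t \<omega> - V t \<omega>)) K \<partial>P) \<le> e / 4" .
    moreover have "C / K = e / 2" using C e by (simp add: K_def)
    ultimately show ?thesis
      using expectation_truncation_le(2)[OF h(1,2) tr_abs_powr_nonneg sq K] e by linarith
  qed
  ultimately show thesis by (rule that)
qed

text \<open>The approximation needs continuity and start at \<open>0\<close> for every path.  Replacing \<open>X\<close> by \<open>0\<close> on an exceptional null set achieves this; the
modification remains adapted because null sets belong to \<open>F 0\<close>.\<close>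

lemma matrix_martingale_in_tilde:
  fixes X :: "real \<Rightarrow> 'w \<Rightarrow> complex^'n^'n"
  assumes X: "matrix_martingale X" and null: "\<And>N. N \<in> null_sets P \<Longrightarrow> N \<in> sets (F 0)"
    and cont: "AE \<omega> in P. continuous_on {0..} (\<lambda>t. X t \<omega>)" and X0: "AE \<omega> in P. X 0 \<omega> = 0" and p: "0 < p"
  shows "X \<in> Lp_martingales_tilde P F p"
proof -
  have "AE \<omega> in P. continuous_on {0..} (\<lambda>t. X t \<omega>) \<and> X 0 \<omega> = 0" using cont X0 by (rule AE_conjI)
  then obtain N0 where N0: "{\<omega> \<in> space P. \<not> (continuous_on {0..} (\<lambda>t. X t \<omega>) \<and> X 0 \<omega> = 0)} \<subseteq> N0"
    "N0 \<in> null_sets P" by (rule AE_E3) blast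
  define V where "V t \<omega> = (if \<omega> \<in> N0 then 0 else X t \<omega>)" for t \<omega>
  have eq: "AE \<omega> in P. V t \<omega> = X t \<omega>" for t
    using AE_not_in[OF N0(2)] by eventually_elim (simp add: V_def)
  have V: "matrix_martingale V"
    unfolding matrix_martingale_def
  proof (intro allI moment_martingale_AE_cong[OF matrix_martingaleD[OF X]])
    fix v and t :: real assume t: "0 \<le> t"
    have "N0 \<in> sets (F t)" using null[OF N0(2)] sets_mono[OF order_refl t] by blast
    then have "V t \<in> borel_measurable (F t)"
      unfolding V_def using matrix_martingale_measurable(1)[OF X t] by (intro measurable_If_set) auto
    then show "(\<lambda>\<omega>. V t \<omega> \<bullet> v) \<in> borel_measurable (F t)" by (intro borel_measurable_inner) auto
    show "AE \<omega> in P. V t \<omega> \<bullet> v = X t \<omega> \<bullet> v" using eq[of t] by eventually_elim simp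
  qed
  have contV: "continuous_on {0..} (\<lambda>t. V t \<omega>)" and V0: "V 0 \<omega> = 0" if "\<omega> \<in> space P" for \<omega>
    using N0(1) that by (cases "\<omega> \<in> N0"; auto simp: V_def)+
  have XL: "X \<in> Lp_martingales P F p" by (rule matrix_martingale_in_Lp_martingales[OF X p cont])
  show ?thesis
    unfolding Lp_martingales_tilde_def in_closure_of topspace_Lp_topology openin_Lp_topology
  proof (intro conjI allI impI XL)
    fix U assume U: "X \<in> U \<and> Lp_open P F p U"
    obtain K e where K: "compact K" "K \<subseteq> {0..}" "0 < e"
      and sub: "\<forall>N\<in>Lp_martingales P F p. (\<forall>t\<in>K. Lp_norm P p (\<lambda>\<omega>. N t \<omega> - X t \<omega>) < e) \<longrightarrow> N \<in> U"
      using Lp_openD[of P F p U X] U by blast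
    obtain T where T: "\<And>t. t \<in> K \<Longrightarrow> norm t \<le> T" "0 < T"
      using compact_imp_bounded[OF K(1)] unfolding bounded_pos by blast
    have "0 < e powr p" using K(3) by simp
    then obtain N where N: "N \<in> Linf_martingales P F" "N \<in> Lp_martingales P F p"
      "\<And>t. 0 \<le> t \<Longrightarrow> t \<le> T \<Longrightarrow> (\<integral>\<omega>. tr_abs_powr p (N t \<omega> - V t \<omega>) \<partial>P) < e powr p"
      using matrix_martingale_approximation[OF V contV V0 p less_imp_le[OF T(2)]] by blast
    have "Lp_norm P p (\<lambda>\<omega>. N t \<omega> - X t \<omega>) < e" if t: "t \<in> K" for t
    proof -
      have t': "0 \<le> t" "t \<le> T" using K(2) T(1)[OF t] t by auto
      have Nm: "N t \<in> borel_measurable P"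
        using N(2) t' measurable_P unfolding Lp_martingales_def Lp_mat_def by blast
      have tr: "(\<lambda>\<omega>. tr_abs_powr p (A \<omega>)) \<in> borel_measurable P" if "A \<in> borel_measurable P" for A :: "'w \<Rightarrow> complex^'n^'n"
        using measurable_compose[OF that tr_abs_powr_borel[OF p]] .
      have "(\<integral>\<omega>. tr_abs_powr p (N t \<omega> - X t \<omega>) \<partial>P) = (\<integral>\<omega>. tr_abs_powr p (N t \<omega> - V t \<omega>) \<partial>P)"
      proof (rule integral_cong_AE)
        show "AE \<omega> in P. tr_abs_powr p (N t \<omega> - X t \<omega>) = tr_abs_powr p (N t \<omega> - V t \<omega>)"
          using eq[of t] by eventually_elim simp
      qed (intro tr borel_measurable_diff Nm matrix_martingale_measurable(2)[OF X t'(1)] matrix_martingale_measurable(2)[OF V t'(1)])+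
      also have "\<dots> < e powr p" using N(3)[OF t'] .
      finally have "(\<integral>\<omega>. tr_abs_powr p (N t \<omega> - X t \<omega>) \<partial>P) powr (1 / p) < (e powr p) powr (1 / p)"
        using p by (intro powr_less_mono2 Bochner_Integration.integral_nonneg tr_abs_powr_nonneg) auto
      also have "\<dots> = e" using p K(3) by (simp add: powr_powr)
      finally show ?thesis unfolding Lp_norm_eq .
    qed
    with sub N(2) have "N \<in> U" by blast
    with N(1) show "\<exists>N. N \<in> Linf_martingales P F \<and> N \<in> U" by blast
  qed
qed

end

section \<open>Hermitian Brownian motion\<close>

text \<open>On real parts, the trace inner product is the standard inner product of the ambient real vector space up to the factor \<open>1/n\<close>.\<close>

lemma Re_tr_inner: "Re (tr_inner a b) = (a \<bullet> b) / CARD('n)" for a b :: "complex^'n^'n"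
proof -
  have "Re (trace (ctransp b ** a)) = (\<Sum>i\<in>UNIV. \<Sum>k\<in>UNIV. (a $ k $ i) \<bullet> (b $ k $ i))"
    by (simp add: trace_def matrix_matrix_mult_def ctransp_def inner_complex_def mult.commute)
  also have "\<dots> = a \<bullet> b" unfolding inner_vec_def by (rule sum.swap)
  finally show ?thesis by (simp add: tr_inner_def ntrace_def)
qed

lemma hermitian_onb_expansion:
  fixes A :: "complex^'n^'n"
  assumes E: "hermitian_onb E" and A: "hermitian A"
  shows "A = (\<Sum>e\<in>E. Re (tr_inner A e) *\<^sub>R e)"
proof -
  have fin: "finite E" and sp: "A \<in> span E" using E A by (auto simp: hermitian_onb_def)
  obtain u where u: "A = (\<Sum>e\<in>E. u e *\<^sub>R e)" using sp fin by (auto simp: span_finite)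
  have "Re (tr_inner A f) = u f" if f: "f \<in> E" for f
  proof -
    have on: "Re (tr_inner e f) = (if e = f then 1 else 0)" if "e \<in> E" for e
      using E f that by (auto simp: hermitian_onb_def)
    have "Re (tr_inner A f) = (\<Sum>e\<in>E. u e * Re (tr_inner e f))"
      unfolding Re_tr_inner u by (simp add: inner_sum_left sum_divide_distrib)
    also have "\<dots> = (\<Sum>e\<in>E. if e = f then u e else 0)"
      by (intro sum.cong refl) (simp add: on)
    also have "\<dots> = u f" using fin f by (simp add: sum.delta)
    finally show ?thesis .
  qed
  then show ?thesis using u by simp
qed

context filtered_space
begin

lemma indep_set_mono: "indep_set A B \<Longrightarrow> A' \<subseteq> A \<Longrightarrow> B' \<subseteq> B \<Longrightarrow> indep_set A' B'"
  unfolding indep_sets2_eq by (simp add: subset_iff)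

text \<open>Each coordinate inherits law and independence from the vector of increments: its law is a marginal of the product measure,
and its events are events of the vector.\<close>

lemma std_brownian_increment:
  assumes W: "std_brownian P F I W" and i: "i \<in> I" and st: "0 \<le> s" "s < t"
  defines "D \<equiv> \<lambda>\<omega>. W i t \<omega> - W i s \<omega>"
  shows "D \<in> borel_measurable P"
    and "distr P borel D = density lborel (\<lambda>x. ennreal (normal_density 0 (sqrt (t - s)) x))"
    and "indep_set (sets (F s)) {D -` B \<inter> space P | B. B \<in> sets borel}"
proof -
  let ?N = "density lborel (\<lambda>x. ennreal (normal_density 0 (sqrt (t - s)) x))"
  define \<Delta> where "\<Delta> = (\<lambda>\<omega>. \<lambda>i\<in>I. W i t \<omega> - W i s \<omega>)"
  have adapted: "W j u \<in> borel_measurable P" if "j \<in> I" "0 \<le> u" for j u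
    using W that measurable_P[OF that(2)] unfolding std_brownian_def by blast
  have indep: "indep_set (sets (F s)) {\<Delta> -` B \<inter> space P | B. B \<in> sets (PiM I (\<lambda>_. borel))}"
    and distr: "distr P (PiM I (\<lambda>_. borel)) \<Delta> = PiM I (\<lambda>_. ?N)"
    using W st unfolding std_brownian_def Let_def \<Delta>_def by blast+
  show Dm: "D \<in> borel_measurable P"
    unfolding D_def using adapted[OF i] st by (intro borel_measurable_diff) auto
  have \<Delta>m: "\<Delta> \<in> measurable P (PiM I (\<lambda>_. borel))"
    unfolding \<Delta>_def using adapted st by (intro measurable_restrict borel_measurable_diff) auto
  have D: "D = (\<lambda>\<omega>. \<Delta> \<omega> i)" using i by (simp add: D_def \<Delta>_def fun_eq_iff)
  have comp: "(\<lambda>x. x i) \<in> measurable (PiM I (\<lambda>_. borel)) (borel :: real measure)"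
    using i by (rule measurable_component_singleton)
  have pN: "prob_space ?N" using st by (intro prob_space_normal_density) auto
  have "distr P borel D = distr (distr P (PiM I (\<lambda>_. borel)) \<Delta>) borel (\<lambda>x. x i)"
    unfolding D using distr_distr[OF comp \<Delta>m] by (simp add: comp_def)
  also have "\<dots> = distr (PiM I (\<lambda>_. ?N)) ?N (\<lambda>x. x i)"
    unfolding distr by (rule distr_cong) auto
  also have "\<dots> = ?N" using pN i by (intro distr_PiM_component)
  finally show "distr P borel D = ?N" .
  have "{D -` B \<inter> space P | B. B \<in> sets borel} \<subseteq> {\<Delta> -` B \<inter> space P | B. B \<in> sets (PiM I (\<lambda>_. borel))}"
  proof safe
    fix B :: "real set" assume B: "B \<in> sets borel"
    have "D -` B \<inter> space P = \<Delta> -` ((\<lambda>x. x i) -` B \<inter> space (PiM I (\<lambda>_. borel))) \<inter> space P"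
      using measurable_space[OF \<Delta>m] by (auto simp: D)
    then show "\<exists>B'. D -` B \<inter> space P = \<Delta> -` B' \<inter> space P \<and> B' \<in> sets (PiM I (\<lambda>_. borel))"
      using measurable_sets[OF comp B] by blast
  qed
  then show "indep_set (sets (F s)) {D -` B \<inter> space P | B. B \<in> sets borel}"
    by (rule indep_set_mono[OF indep order_refl])
qed

lemma integral_indep_increment:
  fixes D :: "'w \<Rightarrow> real"
  assumes A: "A \<in> sets (F s)" and s: "0 \<le> s" and D: "D \<in> borel_measurable P" "integrable P D" "(\<integral>\<omega>. D \<omega> \<partial>P) = 0"
    and ind: "indep_set (sets (F s)) {D -` B \<inter> space P | B. B \<in> sets borel}"
  shows "(\<integral>\<omega>\<in>A. D \<omega> \<partial>P) = 0"
proof -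
  have AP: "A \<in> sets P" using sets_F[OF s A] .
  have mA: "(indicator A :: 'w \<Rightarrow> real) \<in> borel_measurable (F s)" using A by simp
  have V: "sets (vimage_algebra (space P) D borel) = {D -` B \<inter> space P | B. B \<in> sets borel}"
    by (rule sets_vimage_algebra2) simp
  have 1: "sigma_sets (space P) {indicator A -` B \<inter> space P | B. B \<in> sets (borel :: real measure)} \<subseteq> sets (F s)"
  proof -
    have "{indicator A -` B \<inter> space P | B. B \<in> sets (borel :: real measure)} \<subseteq> sets (F s)"
      using measurable_sets[OF mA] space_F[OF s] by auto
    from sets.sigma_sets_subset[OF this] show ?thesis unfolding space_F[OF s] .
  qed
  have 2: "sigma_sets (space P) {D -` B \<inter> space P | B. B \<in> sets borel} = {D -` B \<inter> space P | B. B \<in> sets borel}"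
    using sets.sigma_sets_eq[of "vimage_algebra (space P) D borel"] unfolding V by simp
  have "indep_set (sigma_sets (space P) {indicator A -` B \<inter> space P | B. B \<in> sets (borel :: real measure)})
      (sigma_sets (space P) {D -` B \<inter> space P | B. B \<in> sets borel})"
    unfolding 2 by (rule indep_set_mono[OF ind 1 order_refl])
  then have iv: "indep_var borel (indicator A :: 'w \<Rightarrow> real) borel D"
    unfolding indep_var_eq using D(1) AP by simp
  have "(\<integral>\<omega>. indicator A \<omega> * D \<omega> \<partial>P) = (\<integral>\<omega>. indicator A \<omega> \<partial>P) * (\<integral>\<omega>. D \<omega> \<partial>P)"
    using AP D by (intro indep_var_lebesgue_integral[OF iv]) (auto simp: emeasure_eq_measure)
  then show ?thesis using D(3) by (simp add: set_lebesgue_integral_def)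
qed

text \<open>Increments are centred normal variables independent of the past, so they have finite moments and their integral over
past events vanishes.\<close>

lemma std_brownian_moment_martingale:
  assumes W: "std_brownian P F I W" and i: "i \<in> I"
  shows "moment_martingale (W i)"
proof -
  have adapted: "W i t \<in> borel_measurable (F t)" if "0 \<le> t" for t
    using W i that unfolding std_brownian_def by blast
  have W0: "AE \<omega> in P. W i 0 \<omega> = 0" using W i unfolding std_brownian_def by blast
  have incr: "has_moments P (\<lambda>\<omega>. W i t \<omega> - W i s \<omega>)" "(\<integral>\<omega>. W i t \<omega> - W i s \<omega> \<partial>P) = 0"
    if st: "0 \<le> s" "s < t" for s t
  proof -
    let ?D = "\<lambda>\<omega>. W i t \<omega> - W i s \<omega>" and ?n = "normal_density 0 (sqrt (t - s))"
    note D = std_brownian_increment[OF W i st]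
    have pos: "0 < sqrt (t - s)" using st by simp
    have nd: "?n \<in> borel_measurable lborel" "AE x in lborel. 0 \<le> ?n x"
      by (auto simp: normal_density_nonneg)
    have "integrable P (\<lambda>\<omega>. ?D \<omega> ^ k)" for k
    proof -
      have "integrable (distr P borel ?D) (\<lambda>x. x ^ k)"
        unfolding D(2) using integrable_normal_moment[OF pos, of 0 k] nd
        by (subst integrable_density) auto
      then show ?thesis using D(1) by (subst (asm) integrable_distr_eq) auto
    qed
    then show "has_moments P ?D" using D(1) by (simp add: has_moments_def)
    have "(\<integral>\<omega>. ?D \<omega> \<partial>P) = (\<integral>x. x \<partial>distr P borel ?D)"
      using D(1) by (subst integral_distr) auto
    also have "\<dots> = 0"
      unfolding D(2) using integral_normal_moment_nz_1[OF pos, of 0] nd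
      by (subst integral_density) auto
    finally show "(\<integral>\<omega>. ?D \<omega> \<partial>P) = 0" .
  qed
  have m0: "has_moments P (W i 0)"
    by (rule has_moments_bounded[of _ 0]) (use measurable_P[OF order_refl adapted] W0 in auto)
  have mom: "has_moments P (W i t)" if t: "0 \<le> t" for t
  proof (cases "t = 0")
    case False
    then have "0 < t" using t by simp
    show ?thesis
      by (rule has_moments_dominated[OF incr(1)[OF order_refl \<open>0 < t\<close>] m0 measurable_P[OF t adapted[OF t]]]) auto
  qed (simp add: m0)
  show ?thesis
  proof (rule moment_martingaleI[OF adapted mom])
    fix s t A assume st: "0 \<le> s" "s \<le> t" and A: "A \<in> sets (F s)"
    show "(\<integral>\<omega>\<in>A. W i t \<omega> \<partial>P) = (\<integral>\<omega>\<in>A. W i s \<omega> \<partial>P)"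
    proof (cases "s = t")
      case False
      then have lt: "s < t" using st by simp
      note D = std_brownian_increment[OF W i st(1) lt]
      have z: "(\<integral>\<omega>\<in>A. (W i t \<omega> - W i s \<omega>) \<partial>P) = 0"
        by (rule integral_indep_increment[OF A st(1) D(1) has_momentsD(3)[OF incr(1)[OF st(1) lt]] incr(2)[OF st(1) lt] D(3)])
      have t: "0 \<le> t" using st by simp
      have "set_integrable P A (W i u)" if "0 \<le> u" for u
        unfolding set_integrable_def
        by (rule integrable_mult_indicator[OF sets_F[OF st(1) A] has_momentsD(3)[OF mom[OF that]]])
      from set_integral_diff(2)[OF this[OF t] this[OF st(1)]] z show ?thesis by simp
    qed simp
  qed
qed

text \<open>By the expansion of \<open>X t\<close> in the orthonormal basis, every pairing \<open>X t \<bullet> v\<close> is a fixed linear combination of the coordinate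
Brownian motions.\<close>

lemma hermitian_brownian_matrix_martingale:
  assumes X: "hermitian_brownian P F X"
  shows "matrix_martingale X" "AE \<omega> in P. X 0 \<omega> = 0" "AE \<omega> in P. continuous_on {0..} (\<lambda>t. X t \<omega>)"
proof -
  obtain E where E: "hermitian_onb E" and W: "std_brownian P F E (\<lambda>e t \<omega>. Re (tr_inner (X t \<omega>) e))"
    and H: "\<And>t \<omega>. 0 \<le> t \<Longrightarrow> \<omega> \<in> space P \<Longrightarrow> hermitian (X t \<omega>)"
    and Xm: "\<And>t. 0 \<le> t \<Longrightarrow> X t \<in> borel_measurable (F t)"
    using X unfolding hermitian_brownian_def by blast
  show "AE \<omega> in P. continuous_on {0..} (\<lambda>t. X t \<omega>)" using X unfolding hermitian_brownian_def by blast
  have fin: "finite E" using E by (simp add: hermitian_onb_def)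
  have exp: "X t \<omega> = (\<Sum>e\<in>E. Re (tr_inner (X t \<omega>) e) *\<^sub>R e)" if "0 \<le> t" "\<omega> \<in> space P" for t \<omega>
    by (rule hermitian_onb_expansion[OF E H[OF that]])
  have mart: "moment_martingale (\<lambda>t \<omega>. \<Sum>e\<in>E. (e \<bullet> v) * Re (tr_inner (X t \<omega>) e))" for v
    by (rule moment_martingale_sum[OF fin std_brownian_moment_martingale[OF W]])
  show "matrix_martingale X"
    unfolding matrix_martingale_def
  proof (intro allI moment_martingale_AE_cong[OF mart])
    fix v and t :: real assume t: "0 \<le> t"
    show "(\<lambda>\<omega>. X t \<omega> \<bullet> v) \<in> borel_measurable (F t)" using Xm[OF t] by (intro borel_measurable_inner) auto
    have "X t \<omega> \<bullet> v = (\<Sum>e\<in>E. (e \<bullet> v) * Re (tr_inner (X t \<omega>) e))" if "\<omega> \<in> space P" for \<omega>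
      by (subst exp[OF t that]) (simp add: inner_sum_left mult.commute)
    then show "AE \<omega> in P. X t \<omega> \<bullet> v = (\<Sum>e\<in>E. (e \<bullet> v) * Re (tr_inner (X t \<omega>) e))" by (rule AE_I2)
  qed
  have "AE \<omega> in P. \<forall>e\<in>E. Re (tr_inner (X 0 \<omega>) e) = 0"
    using W by (intro AE_finite_allI[OF fin]) (auto simp: std_brownian_def)
  then show "AE \<omega> in P. X 0 \<omega> = 0"
    using AE_space
  proof eventually_elim
    case (elim \<omega>)
    then show ?case by (subst exp) (auto intro!: sum.neutral)
  qed
qed

end

theorem theorem3p15:
  fixes P :: "'w measure" and F :: "real \<Rightarrow> 'w measure"
    and X :: "real \<Rightarrow> 'w \<Rightarrow> complex^'n^'n" and p :: real
  assumes "filtered_prob_space P F"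
    and "usual_conditions P F"
    and "hermitian_brownian P F X"
    and "1 \<le> p"
  shows "X \<in> Lp_martingales_tilde P F p"
proof -
  interpret filtered_space P F
  proof (intro filtered_space.intro filtered_space_axioms.intro)
    show "prob_space P" "\<And>t. 0 \<le> t \<Longrightarrow> subalgebra P (F t)"
      "\<And>s t. 0 \<le> s \<Longrightarrow> s \<le> t \<Longrightarrow> sets (F s) \<subseteq> sets (F t)"
      using assms(1) unfolding filtered_prob_space_def by blast+
  qed
  have "N \<in> sets (F 0)" if "N \<in> null_sets P" for N
    using assms(2) that unfolding usual_conditions_def by blast
  from matrix_martingale_in_tilde[OF hermitian_brownian_matrix_martingale(1)[OF assms(3)] this
      hermitian_brownian_matrix_martingale(3,2)[OF assms(3)]] assms(4)
  show ?thesis by simp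
qed

end
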